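(* Let $d\ge1$ and $1<p<\infty$, and suppose that $\varphi$ is a nontrivial function in $H^2(\mathbb{T}^d)\cap H^p(\mathbb{T}^d)$. For $q\in\{2,p\}$ let $T_q$ denote the supporting hyperplane, containing the point $\varphi$, to the ball $B_q=\{f\in H^q(\mathbb{T}^d): \|f\|_{H^q(\mathbb{T}^d)}\le\|\varphi\|_{H^q(\mathbb{T}^d)}\}$ in $H^q(\mathbb{T}^d)$. Then $\varphi$ is a Hilbert point in $H^p(\mathbb{T}^d)$ if and only if $T_p\cap H^2(\mathbb{T}^d) = T_2\cap H^p(\mathbb{T}^d)$.
   Context: $\mathbb{T}^d$ is the $d$-dimensional torus with normalized Haar measure $m_d$; $\widehat f(\alpha)=\int_{\mathbb{T}^d} f(z)\overline{z^\alpha}\,dm_d(z)$ for $\alpha\in\mathbb{Z}^d$. The Hardy space $H^p(\mathbb{T}^d)$ is the closed subspace of $L^p(\mathbb{T}^d)$ of functions $f$ with $\widehat f(\alpha)=0$ for all $\alpha\in\mathbb{Z}^d\setminus\mathbb{N}_0^d$, $\mathbb{N}_0=\{0,1,2,\ldots\}$, with the $L^p$ norm $\|\cdot\|_{H^p(\mathbb{T}^d)}$. Write $\langle f,g\rangle=\int_{\mathbb{T}^d} f\overline g\,dm_d$. A nontrivial (i.e. not a.e. zero) function $\varphi$ in $H^p(\mathbb{T}^d)$ is a Hilbert point in $H^p(\mathbb{T}^d)$ if $\|\varphi\|_{H^p(\mathbb{T}^d)}\le\|\varphi+f\|_{H^p(\mathbb{T}^d)}$ for every $f\in H^p(\mathbb{T}^d)$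 such that $\langle f,\varphi\rangle=0$. When $1\le p<2$, the condition $\langle f,\varphi\rangle=0$ is declared to mean that $f$ lies in the closure in $H^p(\mathbb{T}^d)$ of the set of analytic polynomials $g$ with $\langle g,\varphi\rangle=0$. A supporting hyperplane to $B_q$ containing $\varphi$ is a closed (affine) hyperplane in $H^q(\mathbb{T}^d)$ passing through $\varphi$ such that $B_q$ lies on one side of it; for $1<q<\infty$ it is uniquely determined. *)

theory Defs
  imports "HOL-Probability.Probability"
begin

text \<open>
  The dimension is the size of a finite index type \<open>'d\<close> (nonempty, hence at least one).
  Elements of \<open>L\<^sup>p\<close> and \<open>H\<^sup>p\<close> are represented by functions rather than by classes modulo
  almost everywhere equality. All sets of functions compared below are closed under changing a
  function on a null set (or outside the torus) to another measurable one.
\<close>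

definition circle_measure :: "complex measure" where
  "circle_measure =
     distr (uniform_measure lborel {0..<2 * pi}) (restrict_space borel (sphere 0 1)) cis"

definition torus :: "('d::finite \<Rightarrow> complex) measure" where
  "torus = PiM UNIV (\<lambda>_. circle_measure)"

lemma prob_space_circle_measure: "prob_space circle_measure"
proof -
  interpret prob_space "uniform_measure lborel {0..<2 * pi}"
    by (rule prob_space_uniform_measure) auto
  have "cis \<in> borel_measurable (borel :: real measure)"
    by (intro borel_measurable_continuous_onI continuous_intros)
  then have "cis \<in> measurable (uniform_measure lborel {0..<2 * pi}) (restrict_space borel (sphere 0 1))"
    by (intro measurable_restrict_space2) (auto cong: measurable_cong_sets)
  then show ?thesis
    unfolding circle_measure_def by (rule prob_space_distr)
qed

lemma prob_space_torus: "prob_space torus"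
  unfolding torus_def by (intro prob_space_PiM prob_space_circle_measure)

lemma space_torus: "space torus = {z. \<forall>i. norm (z i) = 1}"
  by (auto simp: torus_def circle_measure_def space_PiM space_restrict_space PiE_def)

definition monomial :: "('d::finite \<Rightarrow> int) \<Rightarrow> ('d \<Rightarrow> complex) \<Rightarrow> complex" where
  "monomial \<alpha> z = (\<Prod>i\<in>UNIV. z i powi \<alpha> i)"

definition fourier_coeff :: "(('d::finite \<Rightarrow> complex) \<Rightarrow> complex) \<Rightarrow> ('d \<Rightarrow> int) \<Rightarrow> complex" where
  "fourier_coeff f \<alpha> = (LINT z|torus. f z * cnj (monomial \<alpha> z))"

definition pairing ::
    "(('d::finite \<Rightarrow> complex) \<Rightarrow> complex) \<Rightarrow> (('d \<Rightarrow> complex) \<Rightarrow> complex) \<Rightarrow> complex" where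
  "pairing f g = (LINT z|torus. f z * cnj (g z))"

definition Lp :: "real \<Rightarrow> (('d::finite \<Rightarrow> complex) \<Rightarrow> complex) set" where
  "Lp p = {f \<in> borel_measurable torus. integrable torus (\<lambda>z. norm (f z) powr p)}"

definition Lp_norm :: "real \<Rightarrow> (('d::finite \<Rightarrow> complex) \<Rightarrow> complex) \<Rightarrow> real" where
  "Lp_norm p f = (LINT z|torus. norm (f z) powr p) powr (1 / p)"

definition Hp :: "real \<Rightarrow> (('d::finite \<Rightarrow> complex) \<Rightarrow> complex) set" where
  "Hp p = {f \<in> Lp p. \<forall>\<alpha>. \<not> (\<forall>i. \<alpha> i \<ge> 0) \<longrightarrow> fourier_coeff f \<alpha> = 0}"

definition analytic_polynomial :: "(('d::finite \<Rightarrow> complex) \<Rightarrow> complex) \<Rightarrow> bool" where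
  "analytic_polynomial g \<longleftrightarrow>
     (\<exists>A c. finite A \<and> (\<forall>\<alpha>\<in>A. \<forall>i. \<alpha> i \<ge> 0) \<and> g = (\<lambda>z. \<Sum>\<alpha>\<in>A. c \<alpha> * monomial \<alpha> z))"

definition Hp_closure ::
    "real \<Rightarrow> (('d::finite \<Rightarrow> complex) \<Rightarrow> complex) set \<Rightarrow> (('d \<Rightarrow> complex) \<Rightarrow> complex) set" where
  "Hp_closure p S = {f \<in> Hp p. \<forall>e>0. \<exists>g\<in>S. Lp_norm p (\<lambda>z. f z - g z) < e}"

text \<open>
  For \<open>p < 2\<close> the integral defining \<open>pairing f \<phi>\<close> need not converge, so orthogonality
  is understood through approximation by polynomials.
\<close>

definition orthogonal_to ::
    "real \<Rightarrow> (('d::finite \<Rightarrow> complex) \<Rightarrow> complex) \<Rightarrow> (('d \<Rightarrow> complex) \<Rightarrow> complex) set" where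
  "orthogonal_to p \<phi> =
     (if p < 2 then Hp_closure p {g. analytic_polynomial g \<and> pairing g \<phi> = 0}
      else {f \<in> Hp p. pairing f \<phi> = 0})"

definition hilbert_point :: "real \<Rightarrow> (('d::finite \<Rightarrow> complex) \<Rightarrow> complex) \<Rightarrow> bool" where
  "hilbert_point p \<phi> \<longleftrightarrow>
     \<phi> \<in> Hp p \<and> \<not> (AE z in torus. \<phi> z = 0) \<and>
     (\<forall>f\<in>orthogonal_to p \<phi>. Lp_norm p \<phi> \<le> Lp_norm p (\<lambda>z. \<phi> z + f z))"

definition Hp_ball ::
    "real \<Rightarrow> (('d::finite \<Rightarrow> complex) \<Rightarrow> complex) \<Rightarrow> (('d \<Rightarrow> complex) \<Rightarrow> complex) set" where
  "Hp_ball q \<phi> = {f \<in> Hp q. Lp_norm q f \<le> Lp_norm q \<phi>}"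

text \<open>
  Only real hyperplanes have sides, so functionals on the complex space \<open>H\<^sup>q\<close> are taken
  to be real-valued and real-linear. Boundedness makes them insensitive to the choice of
  representatives and makes their level sets closed.
\<close>

definition bounded_real_functional ::
    "real \<Rightarrow> ((('d::finite \<Rightarrow> complex) \<Rightarrow> complex) \<Rightarrow> real) \<Rightarrow> bool" where
  "bounded_real_functional q \<Lambda> \<longleftrightarrow>
     (\<forall>f\<in>Hp q. \<forall>g\<in>Hp q. \<Lambda> (\<lambda>z. f z + g z) = \<Lambda> f + \<Lambda> g) \<and>
     (\<forall>f\<in>Hp q. \<forall>r::real. \<Lambda> (\<lambda>z. of_real r * f z) = r * \<Lambda> f) \<and>
     (\<exists>C. \<forall>f\<in>Hp q. \<bar>\<Lambda> f\<bar> \<le> C * Lp_norm q f)"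

definition is_supporting_hyperplane ::
    "real \<Rightarrow> (('d::finite \<Rightarrow> complex) \<Rightarrow> complex) \<Rightarrow> (('d \<Rightarrow> complex) \<Rightarrow> complex) set \<Rightarrow> bool" where
  "is_supporting_hyperplane q \<phi> T \<longleftrightarrow>
     \<phi> \<in> T \<and>
     (\<exists>\<Lambda> c. bounded_real_functional q \<Lambda> \<and> (\<exists>f\<in>Hp q. \<Lambda> f \<noteq> 0) \<and>
        T = {f \<in> Hp q. \<Lambda> f = c} \<and>
        ((\<forall>f\<in>Hp_ball q \<phi>. \<Lambda> f \<le> c) \<or> (\<forall>f\<in>Hp_ball q \<phi>. \<Lambda> f \<ge> c)))"

text \<open>Existence and uniqueness hold for \<open>1 < q\<close> and \<open>\<phi>\<close> in \<open>H\<^sup>q\<close> not almost everywhere zero.\<close>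

definition supporting_hyperplane ::
    "real \<Rightarrow> (('d::finite \<Rightarrow> complex) \<Rightarrow> complex) \<Rightarrow> (('d \<Rightarrow> complex) \<Rightarrow> complex) set" where
  "supporting_hyperplane q \<phi> = (THE T. is_supporting_hyperplane q \<phi> T)"

end

theory Submission
  imports Defs
begin

text \<open>
  Let \<open>L\<^sub>q f\<close> be the integral of \<open>f \<bar>\<phi>\<bar>\<^bsup>q-2\<^esup>\<close> times the conjugate of \<open>\<phi>\<close>. Young's inequality, integrated,
  shows that \<open>q Re (L\<^sub>q f)\<close> is the derivative at \<open>\<phi>\<close> of \<open>\<parallel>\<cdot>\<parallel>\<^sup>q\<close> in direction \<open>f\<close>. Hence the supporting hyperplane
  \<open>T\<^sub>q\<close> is \<open>{f. Re (L\<^sub>q f) = \<parallel>\<phi>\<parallel>\<^sup>q}\<close>, and \<open>\<phi>\<close> is a Hilbert point iff \<open>L\<^sub>p\<close> vanishes on the functions orthogonal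
  to \<open>\<phi>\<close>, that is, on (the closure of) the kernel of \<open>L\<^sub>2\<close>. Both conditions say that \<open>L\<^sub>p\<close> and \<open>L\<^sub>2\<close> are
  proportional on \<open>H\<^sup>2 \<inter> H\<^sup>p\<close>. For \<open>p < 2\<close> this uses the density of analytic polynomials in \<open>H\<^sup>2\<close>.
\<close>

section \<open>Integral means and the duality map\<close>

text \<open>Young's inequality by itself only makes \<open>L\<^sub>q\<close> a subgradient. That it
  is the derivative, so that the supporting hyperplane is unique, comes from using the same
  inequality at the points \<phi> + f/(n+1) and letting n grow by dominated convergence; nothing is
  differentiated under the integral. A hyperplane has sides only over the reals and sees just the
  real part of \<open>L\<^sub>q\<close>; the complex statements are recovered by multiplying f by
  suitable complex scalars. The delicate case is p < 2. There orthogonality is tested on polynomials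
  in the norm of H^p, whereas the hyperplanes are compared on all of H^2 \<inter> H^p. The bridge is
  that \<phi> \<in> L^2 puts |\<phi>|^(p-1) into L^2, so both functionals extend to H^2 and density
  is required only for exponent 2, where discarding the non-analytic terms is an orthogonal
  projection.\<close>

interpretation torus: prob_space "torus :: ('d::finite \<Rightarrow> complex) measure"
  by (rule prob_space_torus)

text \<open>For \<open>a = 0\<close> the value is \<open>0\<close>, also when the exponent \<open>q - 2\<close> is negative.\<close>

definition conj_power :: "real \<Rightarrow> complex \<Rightarrow> complex" where
  "conj_power q a = of_real (norm a powr (q - 2)) * cnj a"

text \<open>This is the functional \<open>L\<^sub>q\<close> of the overview. At q = 2 it is the
  pairing with \<phi>, so the same lemmas serve both hyperplanes and the orthogonality
  condition.\<close>

definition duality ::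
    "real \<Rightarrow> (('d::finite \<Rightarrow> complex) \<Rightarrow> complex) \<Rightarrow> (('d \<Rightarrow> complex) \<Rightarrow> complex) \<Rightarrow> complex" where
  "duality q \<phi> f = (LINT z|torus. f z * conj_power q (\<phi> z))"

text \<open>The q-th power of the norm: pointwise inequalities integrate to it without taking
  roots.\<close>

definition Lp_mass :: "real \<Rightarrow> (('d::finite \<Rightarrow> complex) \<Rightarrow> complex) \<Rightarrow> real" where
  "Lp_mass q f = (LINT z|torus. norm (f z) powr q)"

lemma norm_conj_power: "norm (conj_power q a) = norm a powr (q - 1)"
proof (cases "a = 0")
  case False
  then have "norm a powr (q - 2) * norm a = norm a powr (q - 2) * norm a powr 1"
    by simp
  also have "\<dots> = norm a powr (q - 1)"
    by (subst powr_add [symmetric]) simp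
  finally show ?thesis
    by (simp add: conj_power_def norm_mult)
qed (simp add: conj_power_def)

lemma mult_conj_power: "a * conj_power q a = of_real (norm a powr q)"
proof (cases "a = 0")
  case False
  then have "norm a powr (q - 2) * (norm a)\<^sup>2 = norm a powr (q - 2) * norm a powr 2"
    by simp
  also have "\<dots> = norm a powr q"
    by (subst powr_add [symmetric]) simp
  finally show ?thesis
    by (simp add: conj_power_def mult.left_commute [of a] complex_norm_square [symmetric]
        flip: of_real_power of_real_mult)
qed (simp add: conj_power_def)

lemma conj_power_2: "conj_power 2 a = cnj a"
  by (cases "a = 0") (auto simp: conj_power_def)

text \<open>At 0 the factor with exponent q - 2 may blow up, but the modulus of the product is
  |a|^(q-1), which tends to 0 because q > 1. Continuity of this gradient is what makes the L^q norm
  smooth.\<close>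

lemma isCont_conj_power:
  assumes "1 < q"
  shows "isCont (conj_power q) a"
proof (cases "a = 0")
  case False
  then show ?thesis
    unfolding conj_power_def by (intro continuous_intros) auto
next
  case True
  have "((\<lambda>x::complex. norm x powr (q - 1)) \<longlongrightarrow> 0 powr (q - 1)) (at 0)"
    using assms by (intro tendsto_powr' tendsto_norm_zero tendsto_intros) auto
  then have "(conj_power q \<longlongrightarrow> 0) (at 0)"
    by (subst tendsto_norm_zero_iff [symmetric]) (simp add: norm_conj_power)
  then show ?thesis
    using True by (simp add: isCont_def conj_power_def)
qed

lemma continuous_on_conj_power: "1 < q \<Longrightarrow> continuous_on UNIV (conj_power q)"
  by (simp add: continuous_on_eq_continuous_at isCont_conj_power)

lemma measurable_conj_power [measurable]: "1 < q \<Longrightarrow> conj_power q \<in> borel_measurable borel"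
  by (intro borel_measurable_continuous_onI continuous_on_conj_power)

section \<open>Pointwise convexity inequalities\<close>

lemma Young_powr:
  fixes a b q :: real
  assumes "1 < q" "0 \<le> a" "0 \<le> b"
  shows "q * (a * b powr (q - 1)) \<le> a powr q + (q - 1) * b powr q"
proof -
  have "a * b powr (q - 1) \<le> a powr q / q + (b powr (q - 1)) powr (q / (q - 1)) / (q / (q - 1))"
    using assms by (intro Youngs_inequality) (auto simp: field_simps)
  moreover have "(b powr (q - 1)) powr (q / (q - 1)) = b powr q"
    using assms by (simp add: powr_powr)
  ultimately have "q * (a * b powr (q - 1)) \<le> q * (a powr q / q + b powr q / (q / (q - 1)))"
    using assms by (intro mult_left_mono) auto
  also have "\<dots> = a powr q + (q - 1) * b powr q"
    using assms by (simp add: distrib_left)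
  finally show ?thesis .
qed

text \<open>The graph of |.|^q lies above its tangent plane at v. Since
  \<open>v * conj_power q v\<close> is |v|^q, the terms in v combine and Young's inequality for |u|
  and |v| remains.\<close>

lemma norm_powr_gradient:
  assumes "1 < q"
  shows "norm v powr q + q * Re ((u - v) * conj_power q v) \<le> norm u powr q"
proof -
  have "Re (u * conj_power q v) \<le> norm u * norm v powr (q - 1)"
    by (metis complex_Re_le_cmod norm_conj_power norm_mult)
  then have "q * Re (u * conj_power q v) \<le> q * (norm u * norm v powr (q - 1))"
    using assms by simp
  also have "\<dots> \<le> norm u powr q + (q - 1) * norm v powr q"
    using assms by (intro Young_powr) auto
  finally show ?thesis
    by (simp add: mult_conj_power left_diff_distrib right_diff_distrib)
qed

lemma add_powr_le:
  fixes a b q :: real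
  assumes "0 \<le> q" "0 \<le> a" "0 \<le> b"
  shows "(a + b) powr q \<le> 2 powr q * (a powr q + b powr q)"
proof -
  have "(a + b) powr q \<le> (2 * max a b) powr q"
    using assms by (intro powr_mono2) auto
  also have "\<dots> = 2 powr q * max a b powr q"
    using assms by (simp add: powr_mult)
  also have "\<dots> \<le> 2 powr q * (a powr q + b powr q)"
    by (intro mult_left_mono) (auto simp: max_def)
  finally show ?thesis .
qed

section \<open>L^q as a vector space of functions\<close>

lemma Lp_measurable [measurable_dest]: "f \<in> Lp q \<Longrightarrow> f \<in> borel_measurable torus"
  by (simp add: Lp_def)

lemma Lp_integrable: "f \<in> Lp q \<Longrightarrow> integrable torus (\<lambda>z. norm (f z) powr q)"
  by (simp add: Lp_def)

lemma Lp_mono_norm: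
  assumes "f \<in> borel_measurable torus" "g \<in> Lp q" "0 \<le> q"
    and "\<And>z. z \<in> space torus \<Longrightarrow> norm (f z) \<le> norm (g z)"
  shows "f \<in> Lp q"
proof -
  have "integrable torus (\<lambda>z. norm (f z) powr q)"
  proof (rule Bochner_Integration.integrable_bound [OF Lp_integrable [OF assms(2)]])
    show "(\<lambda>z. norm (f z) powr q) \<in> borel_measurable torus"
      using assms by measurable
    show "AE z in torus. norm (norm (f z) powr q) \<le> norm (norm (g z) powr q)"
      using assms by (intro AE_I2) (simp add: powr_mono2)
  qed
  then show ?thesis
    using assms by (simp add: Lp_def)
qed

text \<open>The common integrable majorant: it dominates sums, duality integrands and the sequences
  in the limit arguments.\<close>

lemma Lp_norm_plus:
  assumes "1 < q" "f \<in> Lp q" "g \<in> Lp q"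
  shows "integrable torus (\<lambda>z. (norm (f z) + norm (g z)) powr q)"
proof (rule Bochner_Integration.integrable_bound)
  show "integrable torus (\<lambda>z. 2 powr q * (norm (f z) powr q + norm (g z) powr q))"
    using assms by (intro integrable_mult_right Bochner_Integration.integrable_add Lp_integrable)
  show "(\<lambda>z. (norm (f z) + norm (g z)) powr q) \<in> borel_measurable torus"
    using assms by measurable
  show "AE z in torus. norm ((norm (f z) + norm (g z)) powr q)
      \<le> norm (2 powr q * (norm (f z) powr q + norm (g z) powr q))"
    using assms by (auto intro!: add_powr_le)
qed

lemma Lp_add:
  assumes "1 < q" "f \<in> Lp q" "g \<in> Lp q"
  shows "(\<lambda>z. f z + g z) \<in> Lp q"
proof -
  have "integrable torus (\<lambda>z. norm (f z + g z) powr q)"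
  proof (rule Bochner_Integration.integrable_bound [OF Lp_norm_plus [OF assms]])
    show "(\<lambda>z. norm (f z + g z) powr q) \<in> borel_measurable torus"
      using assms by measurable
    show "AE z in torus. norm (norm (f z + g z) powr q) \<le> norm ((norm (f z) + norm (g z)) powr q)"
      using assms by (auto intro!: powr_mono2 norm_triangle_ineq)
  qed
  then show ?thesis
    using assms by (auto simp: Lp_def)
qed

lemma Lp_scale:
  assumes "f \<in> Lp q"
  shows "(\<lambda>z. c * f z) \<in> Lp q"
  using assms by (auto simp: Lp_def norm_mult powr_mult)

lemma Lp_diff:
  assumes "1 < q" "f \<in> Lp q" "g \<in> Lp q"
  shows "(\<lambda>z. f z - g z) \<in> Lp q"
  using Lp_add [OF assms(1,2) Lp_scale [OF assms(3), of "-1"]] by simp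

lemma Lp_bounded:
  assumes "f \<in> borel_measurable torus" "0 \<le> q" "\<And>z. z \<in> space torus \<Longrightarrow> norm (f z) \<le> B"
  shows "f \<in> Lp q"
proof -
  have "AE z in torus. norm (norm (f z) powr q) \<le> B powr q"
    using assms by (intro AE_I2) (simp add: powr_mono2)
  then have "integrable torus (\<lambda>z. norm (f z) powr q)"
    using assms(1) by (intro torus.integrable_const_bound [where B = "B powr q"]) measurable
  then show ?thesis
    using assms by (simp add: Lp_def)
qed

text \<open>The torus has mass 1, so 1 + x^q is an integrable majorant of x^r.\<close>

lemma Lp_mono_exponent:
  assumes "0 < r" "r \<le> q" "f \<in> Lp q"
  shows "f \<in> Lp r"
proof -
  have "integrable torus (\<lambda>z. norm (f z) powr r)"
  proof (rule Bochner_Integration.integrable_bound)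
    show "integrable torus (\<lambda>z. 1 + norm (f z) powr q)"
      using assms by (intro Bochner_Integration.integrable_add Lp_integrable) auto
    show "(\<lambda>z. norm (f z) powr r) \<in> borel_measurable torus"
      using assms by measurable
    have "x powr r \<le> 1 + x powr q" if "0 \<le> x" for x :: real
    proof (cases "x \<le> 1")
      case True
      then show ?thesis
        using that assms powr_le1 [of r x] by (smt (verit) powr_ge_zero)
    next
      case False
      then have "x powr r \<le> x powr q"
        using assms by (intro powr_mono) auto
      then show ?thesis by simp
    qed
    then show "AE z in torus. norm (norm (f z) powr r) \<le> norm (1 + norm (f z) powr q)"
      by (auto simp: abs_of_nonneg)
  qed
  then show ?thesis
    using assms by (auto simp: Lp_def)
qed

lemma Lp_1_integrable:
  assumes "1 < q" "f \<in> Lp q"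
  shows "integrable torus f"
proof -
  have "f \<in> Lp 1"
    using assms by (intro Lp_mono_exponent [of 1 q]) auto
  then have "integrable torus (\<lambda>z. norm (f z))"
    by (simp add: Lp_def)
  then show ?thesis
    by (rule integrable_norm_cancel) (use assms in measurable)
qed

text \<open>Both factors are bounded by powers of |f| + |\<phi>| with exponents 1 and q - 1, which
  add up to q.\<close>

lemma integrable_mult_conj_power:
  assumes "1 < q" "f \<in> Lp q" "\<phi> \<in> Lp q"
  shows "integrable torus (\<lambda>z. f z * conj_power q (\<phi> z))"
proof (rule Bochner_Integration.integrable_bound [OF Lp_norm_plus [OF assms]])
  show "(\<lambda>z. f z * conj_power q (\<phi> z)) \<in> borel_measurable torus"
    using assms by measurable
  have "a * b powr (q - 1) \<le> (a + b) powr q" if "0 \<le> a" "0 \<le> b" for a b :: real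
  proof -
    have "a * b powr (q - 1) \<le> (a + b) powr 1 * (a + b) powr (q - 1)"
      using that assms by (intro mult_mono powr_mono2) auto
    also have "\<dots> = (a + b) powr q"
      by (subst powr_add [symmetric]) simp
    finally show ?thesis .
  qed
  then show "AE z in torus. norm (f z * conj_power q (\<phi> z)) \<le> norm ((norm (f z) + norm (\<phi> z)) powr q)"
    by (auto simp: norm_mult norm_conj_power)
qed

section \<open>The duality functional and its convexity estimates\<close>

lemma duality_add:
  assumes "1 < q" "\<phi> \<in> Lp q" "f \<in> Lp q" "g \<in> Lp q"
  shows "duality q \<phi> (\<lambda>z. f z + g z) = duality q \<phi> f + duality q \<phi> g"
  unfolding duality_def using assms
  by (simp add: distrib_right integrable_mult_conj_power)

lemma duality_diff:
  assumes "1 < q" "\<phi> \<in> Lp q" "f \<in> Lp q" "g \<in> Lp q"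
  shows "duality q \<phi> (\<lambda>z. f z - g z) = duality q \<phi> f - duality q \<phi> g"
  unfolding duality_def using assms
  by (simp add: left_diff_distrib integrable_mult_conj_power)

lemma duality_scale: "duality q \<phi> (\<lambda>z. c * f z) = c * duality q \<phi> f"
  unfolding duality_def by (simp add: mult.assoc)

lemma duality_self: "duality q \<phi> \<phi> = of_real (Lp_mass q \<phi>)"
  by (simp add: duality_def Lp_mass_def mult_conj_power)

lemma duality_2: "duality 2 \<phi> f = pairing f \<phi>"
  by (simp add: duality_def pairing_def conj_power_2)

lemma Lp_mass_nonneg: "0 \<le> Lp_mass q f"
  unfolding Lp_mass_def by (intro integral_nonneg_AE) auto

lemma Lp_mass_eq_0_iff:
  assumes "f \<in> Lp q"
  shows "Lp_mass q f = 0 \<longleftrightarrow> (AE z in torus. f z = 0)"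
  unfolding Lp_mass_def
  by (subst integral_nonneg_eq_0_iff_AE) (use assms in \<open>auto simp: Lp_integrable\<close>)

lemma Lp_norm_mass: "Lp_norm q f = Lp_mass q f powr (1 / q)"
  by (simp add: Lp_norm_def Lp_mass_def)

lemma Lp_norm_le_iff: "0 < q \<Longrightarrow> Lp_norm q f \<le> Lp_norm q g \<longleftrightarrow> Lp_mass q f \<le> Lp_mass q g"
  using powr_less_mono2 [of "1 / q" "Lp_mass q g" "Lp_mass q f"]
    powr_mono2 [of "1 / q" "Lp_mass q f" "Lp_mass q g"] Lp_mass_nonneg [of q f] Lp_mass_nonneg [of q g]
  by (cases "Lp_mass q f \<le> Lp_mass q g") (simp_all add: Lp_norm_mass)

lemma Lp_norm_nonneg: "0 \<le> Lp_norm q f"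
  by (simp add: Lp_norm_def)

lemma Lp_norm_eq_0_iff:
  assumes "f \<in> Lp q"
  shows "Lp_norm q f = 0 \<longleftrightarrow> (AE z in torus. f z = 0)"
  using Lp_mass_eq_0_iff [OF assms] by (simp add: Lp_norm_mass)

lemma Lp_norm_scale:
  assumes "0 < q"
  shows "Lp_norm q (\<lambda>z. c * f z) = norm c * Lp_norm q f"
  using assms by (simp add: Lp_norm_def norm_mult powr_mult powr_powr)

text \<open>The tangent inequality integrated, with base point v and competitor u. It is used at
  \<phi>, at perturbations of \<phi>, and for q = 2 as one half of Pythagoras.\<close>

lemma Lp_mass_gradient:
  assumes "1 < q" "u \<in> Lp q" "v \<in> Lp q"
  shows "Lp_mass q v + q * Re (duality q v (\<lambda>z. u z - v z)) \<le> Lp_mass q u"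
proof -
  have uv: "(\<lambda>z. u z - v z) \<in> Lp q"
    using assms by (intro Lp_diff)
  have "Lp_mass q v + q * Re (duality q v (\<lambda>z. u z - v z)) =
      (LINT z|torus. norm (v z) powr q + q * Re ((u z - v z) * conj_power q (v z)))"
    unfolding Lp_mass_def duality_def
      integral_Re [OF integrable_mult_conj_power [OF assms(1) uv assms(3)], symmetric]
    using integrable_Re [OF integrable_mult_conj_power [OF assms(1) uv assms(3)]]
    by (subst Bochner_Integration.integral_add) (simp_all only: Lp_integrable [OF assms(3)]
        integrable_mult_right integral_mult_right_zero)
  also have "\<dots> \<le> (LINT z|torus. norm (u z) powr q)"
    using assms uv
    by (intro integral_mono Bochner_Integration.integrable_add integrable_mult_right integrable_Re
        integrable_mult_conj_power Lp_integrable norm_powr_gradient)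
  finally show ?thesis
    by (simp add: Lp_mass_def)
qed

text \<open>The tangent inequality at \<phi> with competitor f; it puts the ball on one side of the
  hyperplane.\<close>

lemma Re_duality_le_mass:
  assumes "1 < q" "f \<in> Lp q" "\<phi> \<in> Lp q" "Lp_mass q f \<le> Lp_mass q \<phi>"
  shows "Re (duality q \<phi> f) \<le> Lp_mass q \<phi>"
proof -
  have "q * (Re (duality q \<phi> f) - Lp_mass q \<phi>) \<le> 0"
    using Lp_mass_gradient [OF assms(1-3)] assms by (simp add: duality_diff duality_self)
  then show ?thesis
    using assms by (simp add: mult_le_0_iff)
qed

text \<open>Hoelder's inequality: the constant, the norm of \<phi> to the power q - 1, appears as
  mass over norm and is multiplied out so that \<phi> may be null. It follows from the half-space
  bound by scaling f.\<close>

lemma norm_duality_le: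
  assumes "1 < q" "f \<in> Lp q" "\<phi> \<in> Lp q"
  shows "norm (duality q \<phi> f) * Lp_norm q \<phi> \<le> Lp_mass q \<phi> * Lp_norm q f"
proof (cases "Lp_norm q f = 0 \<or> duality q \<phi> f = 0")
  case True
  moreover have "duality q \<phi> f = 0" if "Lp_norm q f = 0"
  proof -
    from that have "AE z in torus. f z = 0"
      using Lp_norm_eq_0_iff assms by blast
    then have "AE z in torus. f z * conj_power q (\<phi> z) = 0"
      by auto
    then show ?thesis
      unfolding duality_def by (rule integral_eq_zero_AE)
  qed
  ultimately show ?thesis
    by (auto simp: Lp_mass_nonneg Lp_norm_nonneg)
next
  case False
  \<comment> \<open>c rotates the value of the functional onto the nonnegative real axis and brings
    f to the norm of \<phi>.\<close>
  define c where "c = of_real (Lp_norm q \<phi> / Lp_norm q f) * cnj (sgn (duality q \<phi> f))"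
  have "norm c = Lp_norm q \<phi> / Lp_norm q f"
    using False by (simp add: c_def norm_mult norm_sgn norm_divide Lp_norm_nonneg)
  then have "Lp_norm q (\<lambda>z. c * f z) = Lp_norm q \<phi>"
    using False assms by (simp add: Lp_norm_scale)
  then have "Lp_mass q (\<lambda>z. c * f z) \<le> Lp_mass q \<phi>"
    using assms Lp_norm_le_iff [of q] by force
  then have "Re (duality q \<phi> (\<lambda>z. c * f z)) \<le> Lp_mass q \<phi>"
    using assms by (intro Re_duality_le_mass Lp_scale)
  moreover have "cnj (sgn w) * w = of_real (norm w)" for w :: complex
    by (cases "w = 0") (simp_all add: sgn_eq complex_norm_square [symmetric] mult.commute [of "cnj w"] power2_eq_square)
  then have "duality q \<phi> (\<lambda>z. c * f z) = of_real (Lp_norm q \<phi> / Lp_norm q f * norm (duality q \<phi> f))"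
    by (simp only: duality_scale c_def mult.assoc of_real_mult)
  ultimately show ?thesis
    using False Lp_norm_nonneg [of q f] by (simp add: field_simps)
qed

text \<open>The tangent inequality is applied at the perturbed point \<open>v n\<close> with
  competitor \<phi>: minimality forces \<open>0 \<le> Re (duality q (v n) f)\<close>, and continuity
  of \<open>conj_power\<close> carries this to \<phi>.\<close>

lemma Re_duality_nonneg_if_minimal:
  assumes q: "1 < q" and f: "f \<in> Lp q" and \<phi>: "\<phi> \<in> Lp q"
    and min: "\<And>t. 0 < t \<Longrightarrow> Lp_mass q \<phi> \<le> Lp_mass q (\<lambda>z. \<phi> z + of_real t * f z)"
  shows "0 \<le> Re (duality q \<phi> f)"
proof -
  \<comment> \<open>The coefficient 1/(n+1) is positive and at most 1, which gives a majorant
    independent of n.\<close>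
  define v where "v n z = \<phi> z + of_real (1 / (real n + 1)) * f z" for n z
  have v: "v n \<in> Lp q" for n
    unfolding v_def using assms by (intro Lp_add Lp_scale)
  have pos: "0 \<le> Re (duality q (v n) f)" for n
  proof -
    have "duality q (v n) (\<lambda>z. \<phi> z - v n z) = - of_real (1 / (real n + 1)) * duality q (v n) f"
      using duality_scale [of q "v n" "- of_real (1 / (real n + 1))" f] by (simp add: v_def)
    then have "Lp_mass q (v n) - q * (1 / (real n + 1) * Re (duality q (v n) f)) \<le> Lp_mass q \<phi>"
      using Lp_mass_gradient [OF q \<phi> v, of n] by simp
    also have "\<dots> \<le> Lp_mass q (v n)"
      unfolding v_def by (rule min) simp
    finally show ?thesis
      using q by (simp add: zero_le_mult_iff zero_le_divide_iff)
  qed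
  have "(\<lambda>n. duality q (v n) f) \<longlonglongrightarrow> duality q \<phi> f"
    unfolding duality_def
  proof (rule integral_dominated_convergence)
    show "integrable torus (\<lambda>z. (norm (f z) + norm (\<phi> z)) powr q)"
      using assms by (intro Lp_norm_plus)
    show "(\<lambda>z. f z * conj_power q (\<phi> z)) \<in> borel_measurable torus"
      using assms by measurable
    show "(\<lambda>z. f z * conj_power q (v n z)) \<in> borel_measurable torus" for n
      using assms v[of n] by measurable
    have "(\<lambda>n. v n z) \<longlonglongrightarrow> \<phi> z + of_real 0 * f z" for z
      unfolding v_def using LIMSEQ_Suc [OF lim_1_over_n [where 'a = real]]
      by (intro tendsto_intros) (simp add: add.commute)
    then have "(\<lambda>n. f z * conj_power q (v n z)) \<longlonglongrightarrow> f z * conj_power q (\<phi> z)" for z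
      by (intro tendsto_mult tendsto_const isCont_tendsto_compose [OF isCont_conj_power [OF q]]) simp
    then show "AE z in torus. (\<lambda>n. f z * conj_power q (v n z)) \<longlonglongrightarrow> f z * conj_power q (\<phi> z)"
      by simp
    have "norm (f z * conj_power q (v n z)) \<le> (norm (f z) + norm (\<phi> z)) powr q" for n z
    proof -
      have "norm (v n z) \<le> norm (\<phi> z) + 1 / (real n + 1) * norm (f z)"
        unfolding v_def by (rule norm_triangle_le) (simp add: norm_mult del: of_real_divide)
      also have "\<dots> \<le> norm (\<phi> z) + 1 * norm (f z)"
        by (intro add_mono mult_right_mono) auto
      finally have "norm (f z) * norm (v n z) powr (q - 1) \<le>
          (norm (f z) + norm (\<phi> z)) powr 1 * (norm (f z) + norm (\<phi> z)) powr (q - 1)"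
        using q by (intro mult_mono powr_mono2) auto
      also have "\<dots> = (norm (f z) + norm (\<phi> z)) powr q"
        by (subst powr_add [symmetric]) simp
      finally show ?thesis
        by (simp add: norm_mult norm_conj_power)
    qed
    then show "AE z in torus. norm (f z * conj_power q (v n z)) \<le> (norm (f z) + norm (\<phi> z)) powr q" for n
      by simp
  qed
  then have "(\<lambda>n. Re (duality q (v n) f)) \<longlonglongrightarrow> Re (duality q \<phi> f)"
    by (rule tendsto_Re)
  then show ?thesis
    by (rule LIMSEQ_le_const) (use pos in auto)
qed

section \<open>Supporting hyperplanes\<close>

lemma sets_circle_measure: "sets circle_measure = sets (restrict_space borel (sphere 0 1))"
  by (simp add: circle_measure_def)

lemma measurable_torus_component [measurable]:
  "(\<lambda>z. z i) \<in> borel_measurable (torus :: ('d::finite \<Rightarrow> complex) measure)"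
proof -
  have "(\<lambda>z. z i) \<in> measurable (torus :: ('d \<Rightarrow> complex) measure) circle_measure"
    unfolding torus_def by measurable
  moreover have "(\<lambda>x. x) \<in> borel_measurable circle_measure"
    by (subst measurable_cong_sets [OF sets_circle_measure refl]) (auto intro: measurable_restrict_space1)
  ultimately show ?thesis
    by (rule measurable_compose)
qed

lemma measurable_monomial [measurable]: "monomial \<alpha> \<in> borel_measurable torus"
  unfolding monomial_def power_int_def by measurable

lemma norm_monomial: "z \<in> space torus \<Longrightarrow> norm (monomial \<alpha> z) = 1"
  by (simp add: monomial_def space_torus norm_power_int flip: prod_norm)

lemma measurable_cnj [measurable]: "cnj \<in> borel_measurable borel"
  by (intro borel_measurable_continuous_onI continuous_intros)

lemma integrable_mult_monomial:
  assumes "1 < q" "f \<in> Lp q"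
  shows "integrable torus (\<lambda>z. f z * cnj (monomial \<alpha> z))"
proof (rule Bochner_Integration.integrable_bound [OF Lp_1_integrable [OF assms]])
  show "(\<lambda>z. f z * cnj (monomial \<alpha> z)) \<in> borel_measurable torus"
    using assms by measurable
qed (auto simp: norm_mult norm_monomial)

lemma Hp_Lp: "f \<in> Hp q \<Longrightarrow> f \<in> Lp q"
  by (simp add: Hp_def)

lemma Hp_scale:
  assumes "f \<in> Hp q"
  shows "(\<lambda>z. c * f z) \<in> Hp q"
  using assms by (simp add: Hp_def Lp_scale fourier_coeff_def mult.assoc)

lemma Hp_add:
  assumes "1 < q" "f \<in> Hp q" "g \<in> Hp q"
  shows "(\<lambda>z. f z + g z) \<in> Hp q"
  using assms
  by (simp add: Hp_def Lp_add fourier_coeff_def distrib_right integrable_mult_monomial [of q])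

lemma Hp_diff:
  assumes "1 < q" "f \<in> Hp q" "g \<in> Hp q"
  shows "(\<lambda>z. f z - g z) \<in> Hp q"
  using Hp_add [OF assms(1,2) Hp_scale [OF assms(3), of "-1"]] by simp

lemma Hp_mono_exponent: "0 < r \<Longrightarrow> r \<le> q \<Longrightarrow> f \<in> Hp q \<Longrightarrow> f \<in> Hp r"
  using Lp_mono_exponent [of r q f] by (simp add: Hp_def)

text \<open>By homogeneity \<Lambda> attains its norm at \<phi>. If f is in the kernel of \<Lambda>,
  all \<phi> + t f have the same value, so \<phi> has minimal norm among them and
  \<open>Re (duality q \<phi> f)\<close> vanishes. A real functional vanishing on the kernel of
  another is a multiple of it, and evaluation at \<phi> fixes the factor.\<close>

lemma supporting_functional_eq:
  fixes \<phi> :: "('d::finite \<Rightarrow> complex) \<Rightarrow> complex"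
  assumes q: "1 < q" and \<phi>: "\<phi> \<in> Hp q" and nontrivial: "\<not> (AE z in torus. \<phi> z = 0)"
    and \<Lambda>: "bounded_real_functional q \<Lambda>" and nonzero: "\<exists>f\<in>Hp q. \<Lambda> f \<noteq> 0"
    and ball: "\<And>f. f \<in> Hp_ball q \<phi> \<Longrightarrow> \<Lambda> f \<le> \<Lambda> \<phi>"
  shows "0 < \<Lambda> \<phi>"
    and "f \<in> Hp q \<Longrightarrow> \<Lambda> f * Lp_mass q \<phi> = \<Lambda> \<phi> * Re (duality q \<phi> f)"
proof -
  have \<Lambda>_add: "\<Lambda> (\<lambda>z. f z + g z) = \<Lambda> f + \<Lambda> g" if "f \<in> Hp q" "g \<in> Hp q" for f g
    using \<Lambda> that by (simp add: bounded_real_functional_def)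
  have \<Lambda>_scale: "\<Lambda> (\<lambda>z. of_real r * f z) = r * \<Lambda> f" if "f \<in> Hp q" for f r
    using \<Lambda> that by (simp add: bounded_real_functional_def)
  have norm_pos: "0 < Lp_norm q \<phi>"
    using nontrivial Lp_norm_eq_0_iff [OF Hp_Lp [OF \<phi>]] Lp_norm_nonneg [of q \<phi>] by auto
  have bound: "\<Lambda> f * Lp_norm q \<phi> \<le> \<Lambda> \<phi> * Lp_norm q f" if f: "f \<in> Hp q" for f
  proof (cases "Lp_norm q f = 0")
    \<comment> \<open>Functions vanishing almost everywhere are not identified with 0 here;
      boundedness of \<Lambda> sends them to 0.\<close>
    case True
    moreover obtain C where "\<bar>\<Lambda> f\<bar> \<le> C * Lp_norm q f"
      using \<Lambda> f by (auto simp: bounded_real_functional_def)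
    ultimately show ?thesis
      by simp
  next
    case False
    define r where "r = Lp_norm q \<phi> / Lp_norm q f"
    have pos: "0 < Lp_norm q f"
      using False Lp_norm_nonneg [of q f] by simp
    then have "0 < r"
      using norm_pos by (simp add: r_def)
    then have "Lp_norm q (\<lambda>z. of_real r * f z) = Lp_norm q \<phi>"
      using q pos by (simp add: Lp_norm_scale) (simp add: r_def)
    then have "(\<lambda>z. of_real r * f z) \<in> Hp_ball q \<phi>"
      using f by (simp add: Hp_ball_def Hp_scale)
    then have "r * \<Lambda> f \<le> \<Lambda> \<phi>"
      using ball \<Lambda>_scale f by fastforce
    then show ?thesis
      using pos by (simp add: r_def field_simps)
  qed
  obtain g where g: "g \<in> Hp q" "\<Lambda> g \<noteq> 0"
    using nonzero by blast
  \<comment> \<open>Using both g and -g covers either sign of \<open>\<Lambda> g\<close>, so the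
    right-hand side must be positive.\<close>
  have "\<Lambda> (\<lambda>z. of_real (-1) * g z) * Lp_norm q \<phi> \<le> \<Lambda> \<phi> * Lp_norm q (\<lambda>z. of_real (-1) * g z)"
    by (intro bound Hp_scale g)
  then have "- \<Lambda> g * Lp_norm q \<phi> \<le> \<Lambda> \<phi> * Lp_norm q g"
    using g q by (subst (asm) \<Lambda>_scale, simp, subst (asm) Lp_norm_scale) auto
  moreover have "\<bar>\<Lambda> g\<bar> * Lp_norm q \<phi> > 0"
    using g norm_pos by simp
  ultimately have "0 < \<Lambda> \<phi> * Lp_norm q g"
    using bound [OF g(1)] by (cases "\<Lambda> g \<ge> 0") (simp_all add: abs_if)
  then show pos: "0 < \<Lambda> \<phi>"
    using Lp_norm_nonneg [of q g] by (simp add: zero_less_mult_iff)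
  have nonneg: "0 \<le> Re (duality q \<phi> f)" if f: "f \<in> Hp q" "\<Lambda> f = 0" for f
  proof (rule Re_duality_nonneg_if_minimal)
    fix t :: real
    have "(\<lambda>z. \<phi> z + of_real t * f z) \<in> Hp q"
      using q \<phi> f by (intro Hp_add Hp_scale)
    then have "\<Lambda> (\<lambda>z. \<phi> z + of_real t * f z) * Lp_norm q \<phi> \<le>
        \<Lambda> \<phi> * Lp_norm q (\<lambda>z. \<phi> z + of_real t * f z)"
      by (rule bound)
    then have "Lp_norm q \<phi> \<le> Lp_norm q (\<lambda>z. \<phi> z + of_real t * f z)"
      using f \<phi> pos by (simp add: \<Lambda>_add \<Lambda>_scale Hp_scale)
    then show "Lp_mass q \<phi> \<le> Lp_mass q (\<lambda>z. \<phi> z + of_real t * f z)"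
      using q by (subst (asm) Lp_norm_le_iff) auto
  qed (use q f \<phi> in \<open>auto intro: Hp_Lp\<close>)
  have kernel: "Re (duality q \<phi> f) = 0" if f: "f \<in> Hp q" "\<Lambda> f = 0" for f
  proof -
    have "\<Lambda> (\<lambda>z. of_real (-1) * f z) = 0"
      using f by (subst \<Lambda>_scale) auto
    then have "0 \<le> Re (duality q \<phi> (\<lambda>z. of_real (-1) * f z))"
      using f by (intro nonneg Hp_scale)
    then have "Re (duality q \<phi> f) \<le> 0"
      by (subst (asm) duality_scale) simp
    then show ?thesis
      using nonneg [OF f] by simp
  qed
  show "\<Lambda> f * Lp_mass q \<phi> = \<Lambda> \<phi> * Re (duality q \<phi> f)" if f: "f \<in> Hp q" for f
  proof -
    \<comment> \<open>r moves f along \<phi> into the kernel of \<Lambda>.\<close>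
    define r where "r = - (\<Lambda> f / \<Lambda> \<phi>)"
    have "\<Lambda> (\<lambda>z. f z + of_real r * \<phi> z) = 0"
      using f \<phi> pos by (simp add: \<Lambda>_add \<Lambda>_scale Hp_scale) (simp add: r_def)
    then have "Re (duality q \<phi> (\<lambda>z. f z + of_real r * \<phi> z)) = 0"
      using q f \<phi> by (intro kernel Hp_add Hp_scale)
    moreover have "duality q \<phi> (\<lambda>z. f z + of_real r * \<phi> z) =
        duality q \<phi> f + of_real r * of_real (Lp_mass q \<phi>)"
      using q f \<phi> by (simp add: duality_add Hp_Lp Lp_scale duality_scale duality_self)
    ultimately have "Re (duality q \<phi> f) + r * Lp_mass q \<phi> = 0"
      by simp
    then show ?thesis
      using pos by (simp add: r_def field_simps)
  qed
qed

text \<open>Existence combines the half-space bound with Hoelder's inequality for boundedness.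
  Uniqueness, which gives the definite description its meaning, holds because every supporting
  functional is a positive multiple of the real part of the duality, up to sign.\<close>

lemma supporting_hyperplane_eq:
  fixes \<phi> :: "('d::finite \<Rightarrow> complex) \<Rightarrow> complex"
  assumes q: "1 < q" and \<phi>: "\<phi> \<in> Hp q" and nontrivial: "\<not> (AE z in torus. \<phi> z = 0)"
  shows "supporting_hyperplane q \<phi> = {f \<in> Hp q. Re (duality q \<phi> f) = Lp_mass q \<phi>}"
proof -
  have norm_pos: "0 < Lp_norm q \<phi>"
    using nontrivial Lp_norm_eq_0_iff [OF Hp_Lp [OF \<phi>]] Lp_norm_nonneg [of q \<phi>] by auto
  have mass_pos: "0 < Lp_mass q \<phi>"
    using nontrivial Lp_mass_eq_0_iff [OF Hp_Lp [OF \<phi>]] Lp_mass_nonneg [of q \<phi>] by auto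
  have "bounded_real_functional q (\<lambda>f. Re (duality q \<phi> f))"
    unfolding bounded_real_functional_def
  proof (intro conjI ballI allI exI)
    fix f :: "('d \<Rightarrow> complex) \<Rightarrow> complex" assume f: "f \<in> Hp q"
    have "norm (duality q \<phi> f) * Lp_norm q \<phi> \<le> Lp_mass q \<phi> * Lp_norm q f"
      using q f \<phi> by (intro norm_duality_le Hp_Lp)
    then have "norm (duality q \<phi> f) \<le> Lp_mass q \<phi> / Lp_norm q \<phi> * Lp_norm q f"
      using norm_pos by (simp add: field_simps)
    then show "\<bar>Re (duality q \<phi> f)\<bar> \<le> Lp_mass q \<phi> / Lp_norm q \<phi> * Lp_norm q f"
      using abs_Re_le_cmod order_trans by blast
  qed (use q \<phi> in \<open>auto simp: duality_add Hp_Lp duality_scale\<close>)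
  moreover have "Re (duality q \<phi> f) \<le> Lp_mass q \<phi>" if "f \<in> Hp_ball q \<phi>" for f
    using that q \<phi> by (intro Re_duality_le_mass) (auto simp: Hp_ball_def Hp_Lp Lp_norm_le_iff)
  moreover have "Re (duality q \<phi> \<phi>) = Lp_mass q \<phi>"
    by (simp add: duality_self)
  ultimately have ex: "is_supporting_hyperplane q \<phi> {f \<in> Hp q. Re (duality q \<phi> f) = Lp_mass q \<phi>}"
    unfolding is_supporting_hyperplane_def using \<phi> mass_pos
    by (intro conjI exI [of _ "\<lambda>f. Re (duality q \<phi> f)"] exI [of _ "Lp_mass q \<phi>"]) (auto intro!: bexI [of _ \<phi>])
  \<comment> \<open>The level is written as \<open>\<Lambda> \<phi>\<close> because the hyperplane
    passes through \<phi>.\<close>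
  have unique: "{f \<in> Hp q. \<Lambda> f = \<Lambda> \<phi>} = {f \<in> Hp q. Re (duality q \<phi> f) = Lp_mass q \<phi>}"
    if "bounded_real_functional q \<Lambda>" "\<exists>f\<in>Hp q. \<Lambda> f \<noteq> 0" "\<forall>f\<in>Hp_ball q \<phi>. \<Lambda> f \<le> \<Lambda> \<phi>" for \<Lambda>
  proof -
    have pos: "0 < \<Lambda> \<phi>"
      using supporting_functional_eq(1) [OF q \<phi> nontrivial that(1,2)] that(3) by blast
    have "\<Lambda> f * Lp_mass q \<phi> = \<Lambda> \<phi> * Re (duality q \<phi> f)" if "f \<in> Hp q" for f
      using supporting_functional_eq(2) [OF q \<phi> nontrivial \<open>bounded_real_functional q \<Lambda>\<close>
          \<open>\<exists>f\<in>Hp q. \<Lambda> f \<noteq> 0\<close> _ that] \<open>\<forall>f\<in>Hp_ball q \<phi>. \<Lambda> f \<le> \<Lambda> \<phi>\<close> by blast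
    then have "\<Lambda> f = \<Lambda> \<phi> \<longleftrightarrow> Re (duality q \<phi> f) = Lp_mass q \<phi>" if "f \<in> Hp q" for f
      using that pos mass_pos by (metis less_irrefl mult_cancel_left mult.commute)
    then show ?thesis
      by blast
  qed
  show ?thesis
    unfolding supporting_hyperplane_def
  proof (rule the_equality, rule ex)
    fix T assume "is_supporting_hyperplane q \<phi> T"
    then obtain \<Lambda> c where \<Lambda>: "bounded_real_functional q \<Lambda>" "\<exists>f\<in>Hp q. \<Lambda> f \<noteq> 0"
      and T: "T = {f \<in> Hp q. \<Lambda> f = \<Lambda> \<phi>}"
      and side: "(\<forall>f\<in>Hp_ball q \<phi>. \<Lambda> f \<le> \<Lambda> \<phi>) \<or> (\<forall>f\<in>Hp_ball q \<phi>. \<Lambda> f \<ge> \<Lambda> \<phi>)"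
      unfolding is_supporting_hyperplane_def by auto
    from side show "T = {f \<in> Hp q. Re (duality q \<phi> f) = Lp_mass q \<phi>}"
    proof
      assume "\<forall>f\<in>Hp_ball q \<phi>. \<Lambda> f \<le> \<Lambda> \<phi>"
      then show ?thesis
        using unique [OF \<Lambda>] T by simp
    next
      assume "\<forall>f\<in>Hp_ball q \<phi>. \<Lambda> f \<ge> \<Lambda> \<phi>"
      \<comment> \<open>The other side reduces to the first: the negated functional has the same
        level set through \<phi>.\<close>
      moreover have "bounded_real_functional q (\<lambda>f. - \<Lambda> f)"
        using \<Lambda>(1) unfolding bounded_real_functional_def by auto
      ultimately show ?thesis
        using unique [of "\<lambda>f. - \<Lambda> f"] \<Lambda>(2) T by simp
    qed
  qed
qed

text \<open>Minimality controls only the sign of a real part; closure of V under complex multiples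
  turns this into vanishing. The converse is the tangent inequality at \<phi>. V is abstract because
  orthogonality is defined differently for p < 2 and p \<ge> 2.\<close>

lemma norm_minimal_iff_duality_zero:
  assumes p: "1 < p" and \<phi>: "\<phi> \<in> Lp p" and V: "V \<subseteq> Lp p"
    and scale: "\<And>f c. f \<in> V \<Longrightarrow> (\<lambda>z. c * f z) \<in> V"
  shows "(\<forall>f\<in>V. Lp_norm p \<phi> \<le> Lp_norm p (\<lambda>z. \<phi> z + f z)) \<longleftrightarrow> (\<forall>f\<in>V. duality p \<phi> f = 0)"
proof (intro iffI ballI)
  fix f assume min: "\<forall>f\<in>V. Lp_norm p \<phi> \<le> Lp_norm p (\<lambda>z. \<phi> z + f z)" and f: "f \<in> V"
  \<comment> \<open>With this factor the functional takes the value -|L f|^2 at g, where L is the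
    duality, so a nonnegative real part forces L f = 0.\<close>
  define g where "g z = - cnj (duality p \<phi> f) * f z" for z
  have g: "g \<in> V"
    unfolding g_def using f by (rule scale)
  have "0 \<le> Re (duality p \<phi> g)"
  proof (rule Re_duality_nonneg_if_minimal [OF p _ \<phi>])
    show "Lp_mass p \<phi> \<le> Lp_mass p (\<lambda>z. \<phi> z + of_real t * g z)" for t
      using min scale [OF g] p by (subst Lp_norm_le_iff [symmetric]) auto
  qed (use g V in auto)
  also have "duality p \<phi> g = - of_real ((norm (duality p \<phi> f))\<^sup>2)"
    unfolding g_def duality_scale complex_norm_square by simp
  finally show "duality p \<phi> f = 0"
    by simp
next
  fix f assume zero: "\<forall>f\<in>V. duality p \<phi> f = 0" and f: "f \<in> V"
  have "Lp_mass p \<phi> + p * Re (duality p \<phi> (\<lambda>z. (\<phi> z + f z) - \<phi> z)) \<le> Lp_mass p (\<lambda>z. \<phi> z + f z)"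
    using p \<phi> f V by (intro Lp_mass_gradient Lp_add) auto
  then show "Lp_norm p \<phi> \<le> Lp_norm p (\<lambda>z. \<phi> z + f z)"
    using zero f p by (simp add: Lp_norm_le_iff)
qed

text \<open>Adding a real multiple of \<phi> puts any f on one hyperplane, hence on both, which
  makes the functionals proportional. At \<phi> their values are the masses, so the ratio can only
  be that of the masses; it is stated cross-multiplied.\<close>

lemma supporting_hyperplanes_agree_iff:
  fixes \<phi> :: "('d::finite \<Rightarrow> complex) \<Rightarrow> complex"
  assumes p: "1 < p" and r: "1 < r" and \<phi>: "\<phi> \<in> Hp r \<inter> Hp p"
    and nontrivial: "\<not> (AE z in torus. \<phi> z = 0)"
  shows "supporting_hyperplane p \<phi> \<inter> Hp r = supporting_hyperplane r \<phi> \<inter> Hp p \<longleftrightarrow>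
    (\<forall>f\<in>Hp r \<inter> Hp p. duality p \<phi> f * Lp_mass r \<phi> = duality r \<phi> f * Lp_mass p \<phi>)"
    (is "?L \<longleftrightarrow> ?R")
proof -
  have pos: "0 < Lp_mass q \<phi>" if "\<phi> \<in> Hp q" for q
    using nontrivial Lp_mass_eq_0_iff [OF Hp_Lp [OF that]] Lp_mass_nonneg [of q \<phi>] by auto
  have pos_p: "0 < Lp_mass p \<phi>" and pos_r: "0 < Lp_mass r \<phi>"
    using \<phi> pos by auto
  have "?L \<longleftrightarrow> (\<forall>f\<in>Hp r \<inter> Hp p.
      Re (duality p \<phi> f) = Lp_mass p \<phi> \<longleftrightarrow> Re (duality r \<phi> f) = Lp_mass r \<phi>)"
    using p r \<phi> nontrivial by (auto simp: supporting_hyperplane_eq)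
  also have "\<dots> \<longleftrightarrow> ?R"
  proof
    assume L: "\<forall>f\<in>Hp r \<inter> Hp p. Re (duality p \<phi> f) = Lp_mass p \<phi> \<longleftrightarrow> Re (duality r \<phi> f) = Lp_mass r \<phi>"
    have Re_eq: "Re (duality p \<phi> f) * Lp_mass r \<phi> = Re (duality r \<phi> f) * Lp_mass p \<phi>"
      if f: "f \<in> Hp r \<inter> Hp p" for f
    proof -
      \<comment> \<open>This s places g on the hyperplane for p.\<close>
      define s where "s = 1 - Re (duality p \<phi> f) / Lp_mass p \<phi>"
      define g where "g z = f z + of_real s * \<phi> z" for z
      have g: "g \<in> Hp r \<inter> Hp p"
        unfolding g_def using p r f \<phi> by (auto intro!: Hp_add Hp_scale)
      have duality_g: "Re (duality q \<phi> g) = Re (duality q \<phi> f) + s * Lp_mass q \<phi>"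
        if "1 < q" "f \<in> Hp q" "\<phi> \<in> Hp q" for q
        unfolding g_def using that by (simp add: duality_add Hp_Lp Lp_scale duality_scale duality_self)
      have "Re (duality p \<phi> g) = Lp_mass p \<phi>"
        using p f \<phi> pos_p by (simp add: duality_g) (simp add: s_def field_simps)
      then have "Re (duality r \<phi> g) = Lp_mass r \<phi>"
        using L g by blast
      then show ?thesis
        using r f \<phi> pos_p by (simp add: duality_g) (simp add: s_def field_simps)
    qed
    show ?R
    proof
      fix f :: "('d \<Rightarrow> complex) \<Rightarrow> complex" assume f: "f \<in> Hp r \<inter> Hp p"
      \<comment> \<open>Multiplying f by the imaginary unit yields the equation for the imaginary
        parts.\<close>
      then have "(\<lambda>z. \<i> * f z) \<in> Hp r \<inter> Hp p"
        by (auto intro: Hp_scale)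
      from Re_eq [OF this] Re_eq [OF f]
      show "duality p \<phi> f * Lp_mass r \<phi> = duality r \<phi> f * Lp_mass p \<phi>"
        by (simp add: duality_scale complex_eq_iff)
    qed
  next
    assume R: ?R
    show "\<forall>f\<in>Hp r \<inter> Hp p. Re (duality p \<phi> f) = Lp_mass p \<phi> \<longleftrightarrow> Re (duality r \<phi> f) = Lp_mass r \<phi>"
    proof
      fix f :: "('d \<Rightarrow> complex) \<Rightarrow> complex" assume "f \<in> Hp r \<inter> Hp p"
      then have "Re (duality p \<phi> f * Lp_mass r \<phi>) = Re (duality r \<phi> f * Lp_mass p \<phi>)"
        using R by simp
      then show "Re (duality p \<phi> f) = Lp_mass p \<phi> \<longleftrightarrow> Re (duality r \<phi> f) = Lp_mass r \<phi>"
        using pos_p pos_r by (simp add: mult.commute) (metis less_irrefl mult_cancel_left mult.commute)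
    qed
  qed
  finally show ?thesis .
qed

section \<open>Trigonometric polynomials\<close>

lemma space_circle_measure: "space circle_measure = sphere 0 1"
  by (simp add: circle_measure_def space_restrict_space)

lemma integral_cis_zero:
  assumes "k \<noteq> 0"
  shows "(LINT t|uniform_measure lborel {0..<2 * pi}. cis (of_int k * t)) = 0"
proof -
  have [measurable]: "(\<lambda>t::real. cis (of_int k * t)) \<in> borel_measurable borel"
    by (intro borel_measurable_continuous_onI continuous_intros)
  have "(LINT t|uniform_measure lborel {0..<2 * pi}. cis (of_int k * t)) =
      (LINT t|density lborel (\<lambda>t. ennreal (indicator {0..<2 * pi} t / (2 * pi))). cis (of_int k * t))"
    unfolding uniform_measure_def
    by (intro arg_cong2 [where f = "integral\<^sup>L"] arg_cong2 [where f = density] refl ext)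
       (auto simp: divide_ennreal indicator_def simp flip: ennreal_1)
  also have "\<dots> = (LINT t|lborel. (indicator {0..<2 * pi} t / (2 * pi)) *\<^sub>R cis (of_int k * t))"
    by (rule integral_density) auto
  also have "\<dots> = (LINT t|lborel. indicator {0..2 * pi} t *\<^sub>R ((1 / (2 * pi)) *\<^sub>R cis (of_int k * t)))"
  \<comment> \<open>The measure lives on the half-open interval and the fundamental theorem on the
    closed one; they differ by the null set {2 pi}.\<close>
  proof (rule integral_cong_AE)
    show "AE t in lborel. (indicator {0..<2 * pi} t / (2 * pi)) *\<^sub>R cis (of_int k * t) =
        indicator {0..2 * pi} t *\<^sub>R ((1 / (2 * pi)) *\<^sub>R cis (of_int k * t))"
      using AE_lborel_singleton [of "2 * pi"] by eventually_elim (auto simp: indicator_def)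
    show "(\<lambda>t. (indicator {0..<2 * pi} t / (2 * pi)) *\<^sub>R cis (of_int k * t)) \<in> borel_measurable lborel"
      "(\<lambda>t. indicator {0..2 * pi} t *\<^sub>R ((1 / (2 * pi)) *\<^sub>R cis (of_int k * t))) \<in> borel_measurable lborel"
      by measurable
  qed
  also have "\<dots> = cis (of_int k * (2 * pi)) / (2 * pi * \<i> * of_int k) - cis (of_int k * 0) / (2 * pi * \<i> * of_int k)"
  proof (rule integral_FTC_atLeastAtMost)
    show "((\<lambda>t. cis (of_int k * t) / (2 * pi * \<i> * of_int k)) has_vector_derivative
        (1 / (2 * pi)) *\<^sub>R cis (of_int k * t)) (at t within {0..2 * pi})" for t
    proof -
      have "((\<lambda>t. exp (\<i> * of_int k * of_real t)) has_vector_derivative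
          of_int k * \<i> * exp (\<i> * of_int k * of_real t)) (at t within {0..2 * pi})"
        by (auto intro!: derivative_eq_intros has_vector_derivative_real_field simp: field_simps)
      then have "((\<lambda>t. cis (of_int k * t)) has_vector_derivative \<i> * of_int k * cis (of_int k * t))
          (at t within {0..2 * pi})"
        by (simp add: cis_conv_exp mult_ac)
      then have "((\<lambda>t. cis (of_int k * t) / (2 * pi * \<i> * of_int k)) has_vector_derivative
          \<i> * of_int k * cis (of_int k * t) / (2 * pi * \<i> * of_int k)) (at t within {0..2 * pi})"
        by (rule has_vector_derivative_divide)
      then show ?thesis
        using assms by (simp add: scaleR_conv_of_real)
    qed
  qed (auto intro!: continuous_intros)
  also have "cis (of_int k * (2 * pi)) = 1"
    by (metis cis_multiple_2pi mult.commute Ints_of_int)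
  finally show ?thesis
    by simp
qed

lemma measurable_circle_restrict:
  "f \<in> borel_measurable borel \<Longrightarrow> f \<in> borel_measurable circle_measure"
  by (subst measurable_cong_sets [OF sets_circle_measure refl]) (rule measurable_restrict_space1)

lemma measurable_powi [measurable]: "(\<lambda>z::complex. z powi k) \<in> borel_measurable borel"
  unfolding power_int_def by measurable

lemma cis_mem_circle: "cis \<in> measurable (uniform_measure lborel {0..<2 * pi}) (restrict_space borel (sphere 0 1))"
proof -
  have "cis \<in> borel_measurable (borel :: real measure)"
    by (intro borel_measurable_continuous_onI continuous_intros)
  then show ?thesis
    by (intro measurable_restrict_space2) (auto cong: measurable_cong_sets)
qed

lemma integral_circle_powi_zero:
  assumes "j \<noteq> k"
  shows "(LINT z|circle_measure. z powi j * cnj (z powi k)) = 0"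
proof -
  have "(LINT z|circle_measure. z powi j * cnj (z powi k)) =
      (LINT t|uniform_measure lborel {0..<2 * pi}. cis t powi j * cnj (cis t powi k))"
    unfolding circle_measure_def
    by (intro integral_distr cis_mem_circle measurable_restrict_space1) measurable
  also have "\<dots> = (LINT t|uniform_measure lborel {0..<2 * pi}. cis (of_int (j - k) * t))"
    by (simp add: cis_power_int cis_cnj cis_mult left_diff_distrib)
  also have "\<dots> = 0"
    using assms by (intro integral_cis_zero) simp
  finally show ?thesis .
qed

text \<open>By Fubini the integral is a product of integrals over circles, and a coordinate where
  the exponents differ contributes a factor 0.\<close>

lemma fourier_coeff_monomial:
  fixes \<alpha> \<beta> :: "'d::finite \<Rightarrow> int"
  assumes "\<alpha> \<noteq> \<beta>"
  shows "fourier_coeff (monomial \<beta>) \<alpha> = 0"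
proof -
  interpret circle: prob_space circle_measure
    by (rule prob_space_circle_measure)
  interpret product_sigma_finite "\<lambda>_::'d. circle_measure"
    by standard
  obtain i where i: "\<alpha> i \<noteq> \<beta> i"
    using assms by auto
  have "integrable circle_measure (\<lambda>z. z powi j * cnj (z powi k))" for j k
  proof (rule circle.integrable_const_bound [where B = 1])
    show "(\<lambda>z. z powi j * cnj (z powi k)) \<in> borel_measurable circle_measure"
      by (rule measurable_circle_restrict) measurable
  qed (auto simp: space_circle_measure norm_mult norm_power_int)
  then have "(LINT z|torus. (\<Prod>i\<in>UNIV. z i powi \<beta> i * cnj (z i powi \<alpha> i))) =
      (\<Prod>i\<in>UNIV. LINT z|circle_measure. z powi \<beta> i * cnj (z powi \<alpha> i))"
    unfolding torus_def by (intro product_integral_prod) auto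
  also have "(LINT z|circle_measure. z powi \<beta> i * cnj (z powi \<alpha> i)) = 0"
    using i by (intro integral_circle_powi_zero) simp
  then have "(\<Prod>i\<in>UNIV. LINT z|circle_measure. z powi \<beta> i * cnj (z powi \<alpha> i)) = 0"
    by (intro prod_zero [OF finite] bexI UNIV_I)
  finally show ?thesis
    by (simp add: fourier_coeff_def monomial_def prod.distrib)
qed

section \<open>Analytic and trigonometric polynomials\<close>

lemma monomial_Lp: "0 \<le> q \<Longrightarrow> monomial \<alpha> \<in> Lp q"
  by (rule Lp_bounded [where B = 1]) (auto simp: norm_monomial)

lemma zero_Hp: "(\<lambda>z. 0) \<in> Hp q"
  by (simp add: Hp_def Lp_def fourier_coeff_def)

lemma monomial_Hp:
  assumes "0 \<le> q" and \<alpha>: "\<And>i. 0 \<le> \<alpha> i"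
  shows "monomial \<alpha> \<in> Hp q"
proof -
  have "fourier_coeff (monomial \<alpha>) \<beta> = 0" if "\<not> (\<forall>i. 0 \<le> \<beta> i)" for \<beta>
    using that \<alpha> by (intro fourier_coeff_monomial) auto
  then show ?thesis
    using assms by (simp add: Hp_def monomial_Lp)
qed

lemma analytic_polynomial_Hp:
  assumes "1 < q" "analytic_polynomial g"
  shows "g \<in> Hp q"
proof -
  obtain A c where A: "finite A" "\<And>\<alpha> i. \<alpha> \<in> A \<Longrightarrow> 0 \<le> \<alpha> i"
    and g: "g = (\<lambda>z. \<Sum>\<alpha>\<in>A. c \<alpha> * monomial \<alpha> z)"
    using assms by (auto simp: analytic_polynomial_def)
  from A show ?thesis
    unfolding g
  proof (induction A rule: finite_induct)
    case (insert \<alpha> A)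
    then show ?case
      using assms by (auto intro!: Hp_add Hp_scale monomial_Hp)
  qed (simp add: zero_Hp)
qed

lemma analytic_polynomial_scale:
  assumes "analytic_polynomial g"
  shows "analytic_polynomial (\<lambda>z. b * g z)"
proof -
  obtain A c where "finite A" "\<forall>\<alpha>\<in>A. \<forall>i. 0 \<le> \<alpha> i"
    and g: "g = (\<lambda>z. \<Sum>\<alpha>\<in>A. c \<alpha> * monomial \<alpha> z)"
    using assms by (auto simp: analytic_polynomial_def)
  moreover have "(\<lambda>z. b * g z) = (\<lambda>z. \<Sum>\<alpha>\<in>A. (b * c \<alpha>) * monomial \<alpha> z)"
    by (simp add: g sum_distrib_left mult.assoc)
  ultimately show ?thesis
    unfolding analytic_polynomial_def
    by (intro exI [of _ A] exI [of _ "\<lambda>\<alpha>. b * c \<alpha>"]) simp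
qed

lemma analytic_polynomial_add:
  assumes "analytic_polynomial f" "analytic_polynomial g"
  shows "analytic_polynomial (\<lambda>z. f z + g z)"
proof -
  obtain A a where A: "finite A" "\<forall>\<alpha>\<in>A. \<forall>i. 0 \<le> \<alpha> i"
    and f: "f = (\<lambda>z. \<Sum>\<alpha>\<in>A. a \<alpha> * monomial \<alpha> z)"
    using assms by (auto simp: analytic_polynomial_def)
  obtain B b where B: "finite B" "\<forall>\<alpha>\<in>B. \<forall>i. 0 \<le> \<alpha> i"
    and g: "g = (\<lambda>z. \<Sum>\<alpha>\<in>B. b \<alpha> * monomial \<alpha> z)"
    using assms by (auto simp: analytic_polynomial_def)
  \<comment> \<open>Both coefficient families are extended by 0 to the union of the index sets,
    where they add.\<close>
  define c where "c \<alpha> = (if \<alpha> \<in> A then a \<alpha> else 0) + (if \<alpha> \<in> B then b \<alpha> else 0)" for \<alpha>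
  have "f z + g z = (\<Sum>\<alpha>\<in>A \<union> B. c \<alpha> * monomial \<alpha> z)" for z
  proof -
    have "f z = (\<Sum>\<alpha>\<in>A \<union> B. (if \<alpha> \<in> A then a \<alpha> else 0) * monomial \<alpha> z)"
      unfolding f using A B by (intro sum.mono_neutral_cong_left) auto
    moreover have "g z = (\<Sum>\<alpha>\<in>A \<union> B. (if \<alpha> \<in> B then b \<alpha> else 0) * monomial \<alpha> z)"
      unfolding g using A B by (intro sum.mono_neutral_cong_left) auto
    ultimately show ?thesis
      by (simp add: c_def distrib_right sum.distrib)
  qed
  then show ?thesis
    unfolding analytic_polynomial_def using A B
    by (intro exI [of _ "A \<union> B"] exI [of _ c]) auto
qed

text \<open>The inductive form spares index sets: products and the splitting into analytic and other
  terms go by induction.\<close>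

inductive trig_polynomial :: "(('d::finite \<Rightarrow> complex) \<Rightarrow> complex) \<Rightarrow> bool" where
  monomial: "trig_polynomial (\<lambda>z. c * monomial \<alpha> z)"
| add: "trig_polynomial f \<Longrightarrow> trig_polynomial g \<Longrightarrow> trig_polynomial (\<lambda>z. f z + g z)"

lemma trig_polynomial_Lp: "trig_polynomial f \<Longrightarrow> 1 < q \<Longrightarrow> f \<in> Lp q"
  by (induction rule: trig_polynomial.induct) (auto intro!: Lp_add Lp_scale monomial_Lp)

lemma trig_polynomial_scale:
  assumes "trig_polynomial f"
  shows "trig_polynomial (\<lambda>z. b * f z)"
  using assms
proof (induction rule: trig_polynomial.induct)
  case (monomial c \<alpha>)
  then show ?case
    using trig_polynomial.monomial [of "b * c" \<alpha>] by (simp add: mult.assoc)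
next
  case (add f g)
  then show ?case
    using trig_polynomial.add by (simp add: distrib_left)
qed

lemma trig_polynomial_const: "trig_polynomial (\<lambda>z. c)"
  using trig_polynomial.monomial [of c "\<lambda>_. 0"] by (simp add: monomial_def)

text \<open>The product formula for monomials fails outside the torus, where a coordinate may vanish.\<close>

lemma trig_polynomial_mult:
  fixes f g :: "('d::finite \<Rightarrow> complex) \<Rightarrow> complex"
  assumes "trig_polynomial f" "trig_polynomial g"
  shows "\<exists>h. trig_polynomial h \<and> (\<forall>z\<in>space torus. h z = f z * g z)"
  using assms
proof (induction arbitrary: g rule: trig_polynomial.induct)
  case (monomial c \<alpha>)
  from monomial.prems show ?case
  proof (induction rule: trig_polynomial.induct)
    case (monomial b \<beta>)
    have "monomial (\<lambda>i. \<alpha> i + \<beta> i) z = monomial \<alpha> z * monomial \<beta> z" if "z \<in> space torus" for z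
    proof -
      have "z i \<noteq> 0" for i
        using that by (auto simp: space_torus dest!: spec [of _ i])
      then show ?thesis
        by (simp add: monomial_def power_int_add prod.distrib)
    qed
    then show ?case
      using trig_polynomial.monomial [of "c * b" "\<lambda>i. \<alpha> i + \<beta> i"]
      by (intro exI [of _ "\<lambda>z. c * b * monomial (\<lambda>i. \<alpha> i + \<beta> i) z"]) auto
  next
    case (add g1 g2)
    then obtain h1 h2 where "trig_polynomial h1" "trig_polynomial h2"
      "\<forall>z\<in>space torus. h1 z = c * monomial \<alpha> z * g1 z"
      "\<forall>z\<in>space torus. h2 z = c * monomial \<alpha> z * g2 z"
      by auto
    then show ?case
      by (intro exI [of _ "\<lambda>z. h1 z + h2 z"]) (auto simp: trig_polynomial.add distrib_left)
  qed
next
  case (add f1 f2)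
  then obtain h1 h2 where "trig_polynomial h1" "trig_polynomial h2"
    "\<forall>z\<in>space torus. h1 z = f1 z * g z" "\<forall>z\<in>space torus. h2 z = f2 z * g z"
    by metis
  then show ?case
    by (intro exI [of _ "\<lambda>z. h1 z + h2 z"]) (auto simp: trig_polynomial.add distrib_right)
qed

text \<open>The part a is the Riesz projection of g, read off term by term. A monomial with a
  negative exponent pairs with f to the conjugate of a Fourier coefficient that vanishes for f in
  H^2.\<close>

lemma trig_polynomial_decompose:
  assumes "trig_polynomial g"
  shows "\<exists>a b. analytic_polynomial a \<and> b \<in> Lp 2 \<and> (\<forall>f\<in>Hp 2. pairing b f = 0) \<and> g = (\<lambda>z. a z + b z)"
  using assms
proof (induction rule: trig_polynomial.induct)
  case (monomial c \<alpha>)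
  show ?case
  proof (cases "\<forall>i. 0 \<le> \<alpha> i")
    case True
    then have "analytic_polynomial (\<lambda>z. c * monomial \<alpha> z)"
      unfolding analytic_polynomial_def by (intro exI [of _ "{\<alpha>}"] exI [of _ "\<lambda>_. c"]) auto
    then show ?thesis
      by (intro exI [of _ "\<lambda>z. c * monomial \<alpha> z"] exI [of _ "\<lambda>z. 0"]) (auto simp: Hp_Lp zero_Hp pairing_def)
  next
    case False
    have "analytic_polynomial (\<lambda>z. 0)"
      unfolding analytic_polynomial_def by (intro exI [of _ "{}"]) auto
    moreover have "pairing (\<lambda>z. c * monomial \<alpha> z) f = 0" if "f \<in> Hp 2" for f
    proof -
      have "(LINT z|torus. monomial \<alpha> z * cnj (f z)) = cnj (fourier_coeff f \<alpha>)"
        unfolding fourier_coeff_def by (subst Bochner_Integration.integral_cnj [symmetric]) (simp add: mult.commute)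
      then have "pairing (\<lambda>z. c * monomial \<alpha> z) f = c * cnj (fourier_coeff f \<alpha>)"
        by (simp add: pairing_def mult.assoc)
      then show ?thesis
        using False that by (auto simp: Hp_def)
    qed
    ultimately show ?thesis
      by (intro exI [of _ "\<lambda>z. 0"] exI [of _ "\<lambda>z. c * monomial \<alpha> z"]) (auto simp: Lp_scale monomial_Lp)
  qed
next
  case (add f g)
  then obtain a1 b1 a2 b2 where *: "analytic_polynomial a1" "analytic_polynomial a2" "b1 \<in> Lp 2" "b2 \<in> Lp 2"
    "\<forall>f\<in>Hp 2. pairing b1 f = 0" "\<forall>f\<in>Hp 2. pairing b2 f = 0"
    "f = (\<lambda>z. a1 z + b1 z)" "g = (\<lambda>z. a2 z + b2 z)"
    by blast
  then have "\<forall>f\<in>Hp 2. pairing (\<lambda>z. b1 z + b2 z) f = 0"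
    by (auto simp: duality_2 [symmetric] duality_add Hp_Lp)
  then show ?case
    using * by (intro exI [of _ "\<lambda>z. a1 z + a2 z"] exI [of _ "\<lambda>z. b1 z + b2 z"])
      (auto intro: analytic_polynomial_add Lp_add simp: add_ac)
qed

section \<open>Density of analytic polynomials in \<open>H\<^sup>2\<close>\<close>

text \<open>A triangle inequality up to the factor 2^q, which suffices for closure
  arguments.\<close>

lemma Lp_mass_add_le:
  assumes "1 < q" "f \<in> Lp q" "g \<in> Lp q"
  shows "Lp_mass q (\<lambda>z. f z + g z) \<le> 2 powr q * (Lp_mass q f + Lp_mass q g)"
proof -
  have "Lp_mass q (\<lambda>z. f z + g z) \<le> (LINT z|torus. 2 powr q * (norm (f z) powr q + norm (g z) powr q))"
    unfolding Lp_mass_def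
  proof (intro integral_mono)
    show "integrable torus (\<lambda>z. norm (f z + g z) powr q)"
      using assms by (intro Lp_integrable Lp_add)
    show "integrable torus (\<lambda>z. 2 powr q * (norm (f z) powr q + norm (g z) powr q))"
      using assms by (intro integrable_mult_right Bochner_Integration.integrable_add Lp_integrable)
    fix z :: "'a \<Rightarrow> complex"
    have "norm (f z + g z) powr q \<le> (norm (f z) + norm (g z)) powr q"
      using assms by (intro powr_mono2 norm_triangle_ineq) auto
    also have "\<dots> \<le> 2 powr q * (norm (f z) powr q + norm (g z) powr q)"
      using assms by (intro add_powr_le) auto
    finally show "norm (f z + g z) powr q \<le> 2 powr q * (norm (f z) powr q + norm (g z) powr q)" .
  qed
  also have "\<dots> = 2 powr q * (Lp_mass q f + Lp_mass q g)"
    using assms by (simp add: Lp_mass_def Lp_integrable)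
  finally show ?thesis .
qed

definition trig_approx :: "real \<Rightarrow> (('d::finite \<Rightarrow> complex) \<Rightarrow> complex) \<Rightarrow> bool" where
  "trig_approx q f \<longleftrightarrow>
     f \<in> Lp q \<and> (\<forall>e>0. \<exists>g. trig_polynomial g \<and> Lp_mass q (\<lambda>z. f z - g z) < e)"

lemma trig_approx_trig_polynomial: "1 < q \<Longrightarrow> trig_polynomial f \<Longrightarrow> trig_approx q f"
  unfolding trig_approx_def by (auto intro!: exI [of _ f] trig_polynomial_Lp simp: Lp_mass_def)

lemma trig_approx_limit:
  assumes q: "1 < q" and f: "f \<in> Lp q"
    and approx: "\<And>e. 0 < e \<Longrightarrow> \<exists>h. trig_approx q h \<and> Lp_mass q (\<lambda>z. f z - h z) < e"
  shows "trig_approx q f"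
  unfolding trig_approx_def
proof (intro conjI f allI impI)
  fix e :: real assume e: "0 < e"
  \<comment> \<open>The denominator absorbs the factor 2^q and splits e between two errors.\<close>
  define d where "d = e / (2 * 2 powr q)"
  have d: "0 < d" "2 powr q * (d + d) = e"
    using e by (simp_all add: d_def field_simps)
  obtain h where h: "trig_approx q h" "Lp_mass q (\<lambda>z. f z - h z) < d"
    using approx [OF d(1)] by blast
  obtain g where g: "trig_polynomial g" "Lp_mass q (\<lambda>z. h z - g z) < d"
    using h(1) d(1) unfolding trig_approx_def by blast
  have "Lp_mass q (\<lambda>z. (f z - h z) + (h z - g z)) \<le>
      2 powr q * (Lp_mass q (\<lambda>z. f z - h z) + Lp_mass q (\<lambda>z. h z - g z))"
    using q f h g by (intro Lp_mass_add_le Lp_diff) (auto simp: trig_approx_def trig_polynomial_Lp)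
  also have "\<dots> < 2 powr q * (d + d)"
    using h g by (intro mult_strict_left_mono add_strict_mono) auto
  finally show "\<exists>g. trig_polynomial g \<and> Lp_mass q (\<lambda>z. f z - g z) < e"
    using g d by auto
qed

lemma trig_approx_scale:
  assumes "1 < q" "trig_approx q f"
  shows "trig_approx q (\<lambda>z. c * f z)"
proof (cases "c = 0")
  case True
  then show ?thesis
    using trig_approx_trig_polynomial [OF assms(1) trig_polynomial_const [of 0]] by simp
next
  case False
  show ?thesis
    unfolding trig_approx_def
  proof (intro conjI allI impI)
    show "(\<lambda>z. c * f z) \<in> Lp q"
      using assms by (simp add: trig_approx_def Lp_scale)
    fix e :: real assume "0 < e"
    then obtain g where g: "trig_polynomial g" "Lp_mass q (\<lambda>z. f z - g z) < e / norm c powr q"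
      using assms False unfolding trig_approx_def by (meson divide_pos_pos powr_gt_zero zero_less_norm_iff norm_eq_zero)
    have "Lp_mass q (\<lambda>z. c * f z - c * g z) = norm c powr q * Lp_mass q (\<lambda>z. f z - g z)"
      by (simp add: Lp_mass_def norm_mult powr_mult flip: right_diff_distrib)
    also have "\<dots> < e"
      using g False by (simp add: field_simps)
    finally show "\<exists>g. trig_polynomial g \<and> Lp_mass q (\<lambda>z. c * f z - g z) < e"
      using trig_polynomial_scale [OF g(1)] by blast
  qed
qed

lemma trig_approx_add:
  assumes q: "1 < q" and f: "trig_approx q f" and g: "trig_approx q g"
  shows "trig_approx q (\<lambda>z. f z + g z)"
  unfolding trig_approx_def
proof (intro conjI allI impI)
  show "(\<lambda>z. f z + g z) \<in> Lp q"
    using assms by (auto simp: trig_approx_def intro: Lp_add)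
  fix e :: real assume e: "0 < e"
  define d where "d = e / (2 * 2 powr q)"
  have d: "0 < d" "2 powr q * (d + d) = e"
    using e by (simp_all add: d_def field_simps)
  obtain u where u: "trig_polynomial u" "Lp_mass q (\<lambda>z. f z - u z) < d"
    using f d(1) unfolding trig_approx_def by blast
  obtain v where v: "trig_polynomial v" "Lp_mass q (\<lambda>z. g z - v z) < d"
    using g d(1) unfolding trig_approx_def by blast
  have "Lp_mass q (\<lambda>z. (f z - u z) + (g z - v z)) \<le>
      2 powr q * (Lp_mass q (\<lambda>z. f z - u z) + Lp_mass q (\<lambda>z. g z - v z))"
    using q f g u v by (intro Lp_mass_add_le Lp_diff) (auto simp: trig_approx_def trig_polynomial_Lp)
  also have "\<dots> < 2 powr q * (d + d)"
    using u v by (intro mult_strict_left_mono add_strict_mono) auto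
  finally have "Lp_mass q (\<lambda>z. (f z + g z) - (u z + v z)) < e"
    using d by (simp add: algebra_simps)
  then show "\<exists>h. trig_polynomial h \<and> Lp_mass q (\<lambda>z. f z + g z - h z) < e"
    using trig_polynomial.add [OF u(1) v(1)] by blast
qed

lemma trig_approx_sum:
  assumes "1 < q" "finite A" "\<And>i. i \<in> A \<Longrightarrow> trig_approx q (f i)"
  shows "trig_approx q (\<lambda>z. \<Sum>i\<in>A. f i z)"
  using assms(2,3)
proof (induction A rule: finite_induct)
  case empty
  then show ?case
    using trig_approx_trig_polynomial [OF assms(1) trig_polynomial_const [of 0]] by simp
next
  case (insert i A)
  then show ?case
    using assms(1) by (simp add: trig_approx_add)
qed

text \<open>Converts pointwise convergence under an L^q majorant into approximation in L^q. The
  passages from continuous functions to indicators and from simple functions to L^q go through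
  it.\<close>

lemma trig_approx_dominated_limit:
  assumes q: "1 < q" and f [measurable]: "f \<in> borel_measurable torus" and w: "w \<in> Lp q"
    and h: "\<And>n. trig_approx q (h n)"
    and lim: "\<And>z. z \<in> space torus \<Longrightarrow> (\<lambda>n. h n z) \<longlonglongrightarrow> f z"
    and bound: "\<And>n z. z \<in> space torus \<Longrightarrow> norm (h n z) \<le> norm (w z)"
  shows "trig_approx q f"
proof (rule trig_approx_limit [OF q])
  have h_Lp: "h n \<in> Lp q" for n
    using h by (simp add: trig_approx_def)
  have f_le: "norm (f z) \<le> norm (w z)" if "z \<in> space torus" for z
    by (rule Lim_bounded [OF tendsto_norm [OF lim [OF that]]]) (use bound that in auto)
  then show "f \<in> Lp q"
    using q f w by (intro Lp_mono_norm [of f w]) auto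
  have "(\<lambda>n. Lp_mass q (\<lambda>z. f z - h n z)) \<longlonglongrightarrow> (LINT z|torus. norm (f z - f z) powr q)"
    unfolding Lp_mass_def
  proof (rule integral_dominated_convergence)
    show "integrable torus (\<lambda>z. (norm (w z) + norm (w z)) powr q)"
      using q w by (intro Lp_norm_plus)
    show "(\<lambda>z. norm (f z - h n z) powr q) \<in> borel_measurable torus" for n
      using h_Lp [of n] by measurable
    have "(\<lambda>n. norm (f z - h n z) powr q) \<longlonglongrightarrow> norm (f z - f z) powr q" if "z \<in> space torus" for z
      using q that by (intro tendsto_powr' tendsto_intros lim) auto
    then show "AE z in torus. (\<lambda>n. norm (f z - h n z) powr q) \<longlonglongrightarrow> norm (f z - f z) powr q"
      by (intro AE_I2)
    show "AE z in torus. norm (norm (f z - h n z) powr q) \<le> (norm (w z) + norm (w z)) powr q" for n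
    proof (rule AE_I2)
      fix z :: "'a \<Rightarrow> complex" assume "z \<in> space torus"
      then have "norm (f z - h n z) \<le> norm (w z) + norm (w z)"
        by (intro norm_triangle_le_diff add_mono f_le bound)
      then show "norm (norm (f z - h n z) powr q) \<le> (norm (w z) + norm (w z)) powr q"
        using q by (simp add: powr_mono2)
    qed
  qed simp
  then have "(\<lambda>n. Lp_mass q (\<lambda>z. f z - h n z)) \<longlonglongrightarrow> 0"
    by simp
  then show "\<exists>g. trig_approx q g \<and> Lp_mass q (\<lambda>z. f z - g z) < e" if "0 < e" for e
    using order_tendstoD(2) [of _ 0 sequentially e] that h
    by (meson eventually_False_sequentially eventually_mono)
qed

section \<open>Stone-Weierstrass on the torus\<close>

lemma compact_torus: "compact (space torus :: ('d::finite \<Rightarrow> complex) set)"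
proof -
  have "compactin (product_topology (\<lambda>_. euclidean) UNIV) (Pi\<^sub>E (UNIV :: 'd set) (\<lambda>_. sphere (0::complex) 1))"
    by (subst compactin_PiE) (auto simp: compactin_euclidean_iff)
  moreover have "Pi\<^sub>E (UNIV :: 'd set) (\<lambda>_. sphere (0::complex) 1) = space torus"
    by (auto simp: space_torus PiE_def)
  ultimately show ?thesis
    by (simp add: euclidean_product_topology compactin_euclidean_iff)
qed

lemma monomial_single: "monomial (\<lambda>j. if j = i then k else 0) z = z i powi k"
proof -
  have "monomial (\<lambda>j. if j = i then k else 0) z = (\<Prod>j\<in>UNIV. if j = i then z j powi k else 1)"
    unfolding monomial_def by (intro prod.cong) auto
  then show ?thesis
    by simp
qed

text \<open>On the unit circle the inverse is the conjugate, so these parts combine the exponents 1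
  and -1. Together they separate the points of the torus.\<close>

lemma trig_polynomial_Re_Im:
  "\<exists>h. trig_polynomial h \<and> (\<forall>z\<in>space torus. h z = of_real (Re (z i)))"
  "\<exists>h. trig_polynomial h \<and> (\<forall>z\<in>space torus. h z = of_real (Im (z i)))"
proof -
  let ?m = "\<lambda>k. monomial (\<lambda>j. if j = i then k else 0)"
  have inv: "z i powi (-1) = cnj (z i)" if "z \<in> space torus" for z
  proof -
    have "z i * cnj (z i) = 1"
      using that by (simp add: space_torus flip: complex_norm_square)
    then show ?thesis
      by (simp add: power_int_minus inverse_unique)
  qed
  have "trig_polynomial (\<lambda>z. 1/2 * ?m 1 z + 1/2 * ?m (-1) z)"
    "trig_polynomial (\<lambda>z. - \<i>/2 * ?m 1 z + \<i>/2 * ?m (-1) z)"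
    by (intro trig_polynomial.intros)+
  moreover have "1/2 * ?m 1 z + 1/2 * ?m (-1) z = of_real (Re (z i))"
    "- \<i>/2 * ?m 1 z + \<i>/2 * ?m (-1) z = of_real (Im (z i))" if "z \<in> space torus" for z
    unfolding monomial_single using inv [OF that] by (auto simp: complex_eq_iff)
  ultimately show "\<exists>h. trig_polynomial h \<and> (\<forall>z\<in>space torus. h z = of_real (Re (z i)))"
    "\<exists>h. trig_polynomial h \<and> (\<forall>z\<in>space torus. h z = of_real (Im (z i)))"
    by blast+
qed

lemma trig_approx_continuous:
  fixes u :: "('d::finite \<Rightarrow> complex) \<Rightarrow> real"
  assumes q: "1 < q" and u: "continuous_on (space torus) u" and u_Lp: "(\<lambda>z. of_real (u z)) \<in> Lp q"
  shows "trig_approx q (\<lambda>z. of_real (u z))"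
  unfolding trig_approx_def
proof (intro conjI u_Lp allI impI)
  \<comment> \<open>The real form of the theorem asks for an algebra of real functions. Agreement
    with a trigonometric polynomial is demanded only on the torus, where products of monomials are
    monomials.\<close>
  define R where "R = {f :: ('d \<Rightarrow> complex) \<Rightarrow> real. continuous_on (space torus) f \<and>
    (\<exists>h. trig_polynomial h \<and> (\<forall>z\<in>space torus. h z = of_real (f z)))}"
  interpret function_ring_on R "space torus"
  proof
    show "compact (space torus :: ('d \<Rightarrow> complex) set)"
      by (rule compact_torus)
    show "continuous_on (space torus) f" if "f \<in> R" for f
      using that by (simp add: R_def)
    show "(\<lambda>x. f x + g x) \<in> R" if "f \<in> R" "g \<in> R" for f g
    proof -
      from that obtain a b where "trig_polynomial a" "trig_polynomial b"
        "\<forall>z\<in>space torus. a z = of_real (f z)" "\<forall>z\<in>space torus. b z = of_real (g z)"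
        by (auto simp: R_def)
      then have "\<exists>h. trig_polynomial h \<and> (\<forall>z\<in>space torus. h z = of_real (f z + g z))"
        by (intro exI [of _ "\<lambda>z. a z + b z"]) (auto intro: trig_polynomial.add)
      then show ?thesis
        using that by (auto simp: R_def intro: continuous_on_add)
    qed
    show "(\<lambda>x. f x * g x) \<in> R" if "f \<in> R" "g \<in> R" for f g
    proof -
      from that obtain a b where ab: "trig_polynomial a" "trig_polynomial b"
        "\<forall>z\<in>space torus. a z = of_real (f z)" "\<forall>z\<in>space torus. b z = of_real (g z)"
        by (auto simp: R_def)
      have "\<exists>h. trig_polynomial h \<and> (\<forall>z\<in>space torus. h z = of_real (f z * g z))"
        using trig_polynomial_mult [OF ab(1,2)] ab(3,4) by auto
      then show ?thesis
        using that by (auto simp: R_def intro: continuous_on_mult)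
    qed
    show "(\<lambda>_. c) \<in> R" for c
      using trig_polynomial_const [of "of_real c"] by (auto simp: R_def)
    fix x y :: "'d \<Rightarrow> complex" assume "x \<noteq> y"
    then obtain i where "x i \<noteq> y i"
      by auto
    have cont: "continuous_on (space torus) (\<lambda>z::'d \<Rightarrow> complex. z i)"
      by (rule continuous_on_subset [OF continuous_on_product_coordinates]) simp
    have "(\<lambda>z. Re (z i)) \<in> R" "(\<lambda>z. Im (z i)) \<in> R"
      using trig_polynomial_Re_Im [of i] by (auto simp: R_def intro!: continuous_intros cont)
    then show "\<exists>f\<in>R. f x \<noteq> f y"
      using \<open>x i \<noteq> y i\<close> complex_eq_iff by (metis (no_types, lifting))
  qed
  fix e :: real assume e: "0 < e"
  \<comment> \<open>On a probability space a uniform error d has mass at most d^q, here e/2.\<close>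
  define d where "d = (e / 2) powr (1 / q)"
  have d: "0 < d" "d powr q = e / 2"
    using e q by (simp_all add: d_def powr_powr)
  obtain g where g: "g \<in> R" "\<forall>z\<in>space torus. \<bar>u z - g z\<bar> < d"
    using Stone_Weierstrass_basic [OF u d(1)] by blast
  then obtain h where h: "trig_polynomial h" "\<forall>z\<in>space torus. h z = of_real (g z)"
    by (auto simp: R_def)
  have "Lp_mass q (\<lambda>z. of_real (u z) - h z) \<le> e / 2"
    unfolding Lp_mass_def
  proof (rule torus.integral_le_const)
    show "integrable torus (\<lambda>z. norm (of_real (u z) - h z) powr q)"
      by (intro Lp_integrable Lp_diff q u_Lp trig_polynomial_Lp [OF h(1)])
    show "AE z in torus. norm (of_real (u z) - h z) powr q \<le> e / 2"
    proof (rule AE_I2)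
      fix z :: "'d \<Rightarrow> complex" assume "z \<in> space torus"
      then have "norm (of_real (u z) - h z) \<le> d"
        using g h by (auto simp flip: of_real_diff simp: less_imp_le)
      then have "norm (of_real (u z) - h z) powr q \<le> d powr q"
        using q by (intro powr_mono2) auto
      then show "norm (of_real (u z) - h z) powr q \<le> e / 2"
        using d by simp
    qed
  qed
  then show "\<exists>g. trig_polynomial g \<and> Lp_mass q (\<lambda>z. of_real (u z) - g z) < e"
    using h e by (intro exI [of _ h]) auto
qed

section \<open>From continuous functions to indicators and all of L^q\<close>

lemma measurable_torus_borel: "(\<lambda>z. z) \<in> borel_measurable (torus :: ('d::finite \<Rightarrow> complex) measure)"
  by (rule measurable_coordinatewise_then_product) measurable

text \<open>The torus carries the product sigma-algebra of the circles, while closed sets generate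
  the Borel sets of the whole function space. This inclusion makes the level sets of simple
  functions on the torus Borel; complements relative to the torus stay Borel because the torus is
  compact.\<close>

lemma sets_torus_subset_borel: "sets (torus :: ('d::finite \<Rightarrow> complex) measure) \<subseteq> sets borel"
proof
  fix A :: "('d \<Rightarrow> complex) set"
  assume "A \<in> sets torus"
  then have "A \<in> sigma_sets (space torus)
      {{z \<in> space torus. z i \<in> B} | i B. i \<in> UNIV \<and> B \<in> sets circle_measure}"
    by (simp add: torus_def sets_PiM_single space_PiM)
  then show "A \<in> sets borel"
  proof (induction rule: sigma_sets.induct)
    case (Basic A)
    then obtain i B where "B \<in> sets circle_measure" and A: "A = {z \<in> space torus. z i \<in> B}"
      by auto
    then have "B \<in> sets borel"
      by (auto simp: sets_circle_measure sets_restrict_space)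
    then have "(\<lambda>z::'d \<Rightarrow> complex. z i) -` B \<inter> space borel \<in> sets borel"
      by (rule measurable_sets [OF borel_measurable_continuous_onI [OF continuous_on_product_coordinates]])
    moreover have "space torus \<in> sets (borel :: ('d \<Rightarrow> complex) measure)"
      by (intro borel_compact compact_torus)
    ultimately have "((\<lambda>z. z i) -` B \<inter> space borel) \<inter> space torus \<in> sets borel"
      by (rule sets.Int)
    also have "((\<lambda>z. z i) -` B \<inter> space borel) \<inter> space torus = A"
      by (auto simp: A)
    finally show ?case .
  next
    case (Compl A)
    then show ?case
      using borel_compact [OF compact_torus] by auto
  qed auto
qed

lemma trig_approx_indicator_closed:
  fixes C :: "('d::finite \<Rightarrow> complex) set"
  assumes q: "1 < q" and C: "closed C"
  shows "trig_approx q (indicator C)"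
proof (cases "C = {}")
  \<comment> \<open>\<open>infdist\<close> to the empty set is 0 by convention, so the functions
    below would be constantly 1.\<close>
  case True
  then have "(indicator C :: ('d \<Rightarrow> complex) \<Rightarrow> complex) = (\<lambda>z. 0)"
    by auto
  then show ?thesis
    using trig_approx_trig_polynomial [OF q trig_polynomial_const [of 0]] by simp
next
  case False
  \<comment> \<open>For n > 0 this is 1 on C and 0 at distance at least 1/n; closedness of C makes
    the limit its indicator.\<close>
  define u where "u n z = max 0 (1 - real n * infdist z C)" for n and z :: "'d \<Rightarrow> complex"
  have cont: "continuous_on S (u n)" for n S
    unfolding u_def by (intro continuous_intros)
  have bound: "norm (of_real (u n z) :: complex) \<le> 1" for n z
    by (simp add: u_def infdist_nonneg)
  show ?thesis
  proof (rule trig_approx_dominated_limit [OF q])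
    show "indicator C \<in> borel_measurable torus"
      using measurable_compose [OF measurable_torus_borel borel_measurable_indicator [of C borel]] C by simp
    show one: "(\<lambda>z. 1) \<in> Lp q"
      using q by (intro trig_polynomial_Lp trig_polynomial_const)
    show "trig_approx q (\<lambda>z. of_real (u n z))" for n
    proof (rule trig_approx_continuous [OF q cont])
      have "(\<lambda>z. of_real (u n z) :: complex) \<in> borel_measurable borel"
        by (intro borel_measurable_continuous_onI continuous_intros cont)
      then have "(\<lambda>z. of_real (u n z) :: complex) \<in> borel_measurable torus"
        using measurable_compose [OF measurable_torus_borel] by blast
      then show "(\<lambda>z. of_real (u n z)) \<in> Lp q"
        using q bound one by (intro Lp_mono_norm [OF _ one]) auto
    qed
    show "(\<lambda>n. of_real (u n z)) \<longlonglongrightarrow> (indicator C z :: complex)" for z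
    proof (cases "z \<in> C")
      case True
      then show ?thesis
        by (simp add: u_def)
    next
      case False
      then have pos: "0 < infdist z C"
        using infdist_pos_not_in_closed [OF C \<open>C \<noteq> {}\<close>] by simp
      have "filterlim (\<lambda>n. real n * infdist z C) at_top sequentially"
        by (intro filterlim_at_top_mult_tendsto_pos [OF tendsto_const pos] filterlim_real_sequentially)
      then have "\<forall>\<^sub>F n in sequentially. 1 \<le> real n * infdist z C"
        by (simp add: filterlim_at_top)
      then have "\<forall>\<^sub>F n in sequentially. of_real (u n z) = (indicator C z :: complex)"
        by eventually_elim (use False in \<open>simp add: u_def\<close>)
      then show ?thesis
        by (rule tendsto_eventually)
    qed
    show "norm (of_real (u n z) :: complex) \<le> norm (1 :: complex)" for n z
      using bound by simp
  qed
qed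

text \<open>Closed sets form an intersection-stable generator, so Dynkin's theorem applies:
  complements use linearity, and disjoint unions are dominated limits of finite sums.\<close>

lemma trig_approx_indicator_borel:
  fixes A :: "('d::finite \<Rightarrow> complex) set"
  assumes q: "1 < q" and A: "A \<in> sets borel"
  shows "trig_approx q (indicator A)"
proof -
  have sets_eq: "sets (borel :: ('d \<Rightarrow> complex) measure) = sigma_sets UNIV (Collect closed)"
    by (simp add: borel_eq_closed)
  have "Int_stable (Collect closed :: ('d \<Rightarrow> complex) set set)" "Collect closed \<subseteq> Pow (UNIV :: ('d \<Rightarrow> complex) set)"
    by (auto simp: Int_stable_def)
  moreover have "A \<in> sigma_sets UNIV (Collect closed)"
    using A sets_eq by simp
  ultimately show ?thesis
  proof (induction rule: sigma_sets_induct_disjoint)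
    case (basic A)
    then show ?case
      using q by (simp add: trig_approx_indicator_closed)
  next
    case empty
    show ?case
      using q by (intro trig_approx_indicator_closed) auto
  next
    case (compl A)
    have "trig_approx q (\<lambda>z. indicator UNIV z + (-1) * indicator A z)"
      by (intro trig_approx_add q trig_approx_scale compl trig_approx_indicator_closed closed_UNIV)
    also have "(\<lambda>z. indicator UNIV z + (-1) * indicator A z) = (indicator (UNIV - A) :: ('d \<Rightarrow> complex) \<Rightarrow> complex)"
      by (auto simp: indicator_def)
    finally show ?case .
  next
    case (union A)
    have partial: "trig_approx q (indicator (\<Union>i<n. A i))" for n
    proof -
      have "trig_approx q (\<lambda>z. \<Sum>i<n. indicator (A i) z)"
        using q union by (intro trig_approx_sum) auto
      also have "(\<lambda>z. \<Sum>i<n. indicator (A i) z) = (indicator (\<Union>i<n. A i) :: ('d \<Rightarrow> complex) \<Rightarrow> complex)"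
        using union by (intro ext indicator_UN_disjoint [symmetric]) (auto intro: disjoint_family_on_mono)
      finally show ?thesis .
    qed
    show ?case
    proof (rule trig_approx_dominated_limit [OF q _ _ partial LIMSEQ_indicator_UN])
      show "(\<lambda>z. 1) \<in> Lp q"
        using q by (intro trig_polynomial_Lp trig_polynomial_const)
      have "(\<Union>i. A i) \<in> sets borel"
        unfolding sets_eq using union by (intro sigma_sets.Union) auto
      then show "indicator (\<Union>i. A i) \<in> borel_measurable torus"
        using measurable_compose [OF measurable_torus_borel borel_measurable_indicator [of "\<Union>i. A i" borel]] by simp
    qed (auto simp: indicator_def)
  qed
qed

lemma trig_approx_Lp:
  assumes q: "1 < q" and f: "f \<in> Lp q"
  shows "trig_approx q f"
proof -
  have f_meas: "f \<in> borel_measurable torus"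
    using f by measurable
  obtain F where F: "\<And>i. simple_function torus (F i)"
    and lim: "\<And>z. z \<in> space torus \<Longrightarrow> (\<lambda>i. F i z) \<longlonglongrightarrow> f z"
    and bound: "\<And>i z. z \<in> space torus \<Longrightarrow> norm (F i z) \<le> 2 * norm (f z)"
    using borel_measurable_implies_sequence_metric [OF f_meas, of 0] by simp metis
  \<comment> \<open>Written as a combination of indicators, G is within reach of the closure lemmas;
    it is compared with F on the torus only.\<close>
  define G where "G i z = (\<Sum>y\<in>F i ` space torus. y * indicator (F i -` {y} \<inter> space torus) z)" for i z
  have G: "G i z = F i z" if "z \<in> space torus" for i z
    unfolding simple_function_indicator_representation_banach [OF F that] G_def
    by (intro sum.cong) (auto simp: indicator_def)
  show ?thesis
  proof (rule trig_approx_dominated_limit [OF q f_meas])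
    show "(\<lambda>z. 2 * f z) \<in> Lp q"
      using f by (rule Lp_scale)
    show "trig_approx q (G i)" for i
      unfolding G_def
    proof (intro trig_approx_sum trig_approx_scale trig_approx_indicator_borel q)
      show "finite (F i ` space torus)"
        using F by (rule simple_functionD)
      show "F i -` {y} \<inter> space torus \<in> sets borel" for y
        using F [of i] sets_torus_subset_borel by (auto dest: simple_functionD(2))
    qed
    show "(\<lambda>i. G i z) \<longlonglongrightarrow> f z" if "z \<in> space torus" for z
      using lim [OF that] G [OF that] by simp
    show "norm (G i z) \<le> norm (2 * f z)" if "z \<in> space torus" for i z
      using bound [OF that] G [OF that] by (simp add: norm_mult)
  qed
qed

text \<open>The non-analytic part of a trigonometric polynomial is orthogonal to \<open>H\<^sup>2\<close>, so dropping it
  only improves the \<open>L\<^sup>2\<close> approximation.\<close>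

lemma analytic_polynomial_dense_H2:
  assumes f: "f \<in> Hp 2" and e: "0 < e"
  shows "\<exists>g. analytic_polynomial g \<and> Lp_mass 2 (\<lambda>z. f z - g z) < e"
proof -
  have "trig_approx 2 f"
    using f by (intro trig_approx_Lp Hp_Lp) auto
  then obtain g where g: "trig_polynomial g" "Lp_mass 2 (\<lambda>z. f z - g z) < e"
    using e unfolding trig_approx_def by blast
  obtain a b where a: "analytic_polynomial a" and b: "b \<in> Lp 2" "\<forall>f\<in>Hp 2. pairing b f = 0"
    and g_eq: "g = (\<lambda>z. a z + b z)"
    using trig_polynomial_decompose [OF g(1)] by blast
  have fa: "(\<lambda>z. f z - a z) \<in> Hp 2"
    by (intro Hp_diff f analytic_polynomial_Hp a) auto
  have "Lp_mass 2 (\<lambda>z. f z - a z) + 2 * Re (duality 2 (\<lambda>z. f z - a z) (\<lambda>z. (f z - g z) - (f z - a z)))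
      \<le> Lp_mass 2 (\<lambda>z. f z - g z)"
    by (intro Lp_mass_gradient Lp_diff [OF _ Hp_Lp [OF f] trig_polynomial_Lp [OF g(1)]] Hp_Lp [OF fa]) auto
  moreover have "(\<lambda>z. (f z - g z) - (f z - a z)) = (\<lambda>z. (-1) * b z)"
    by (auto simp: g_eq)
  moreover have "duality 2 (\<lambda>z. f z - a z) (\<lambda>z. (-1) * b z) = 0"
    using b fa unfolding duality_scale duality_2 by simp
  ultimately have "Lp_mass 2 (\<lambda>z. f z - a z) < e"
    using g by simp
  then show ?thesis
    using a by blast
qed

text \<open>Hoelder's inequality makes the functional continuous, so its kernel is closed in
  L^q.\<close>

lemma duality_zero_closure:
  assumes q: "1 < q" and \<phi>: "\<phi> \<in> Lp q" and f: "f \<in> Lp q"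
    and approx: "\<And>e. 0 < e \<Longrightarrow> \<exists>g\<in>Lp q. duality q \<phi> g = 0 \<and> Lp_norm q (\<lambda>z. f z - g z) < e"
  shows "duality q \<phi> f = 0"
proof (cases "Lp_norm q \<phi> = 0")
  case True
  then have "AE z in torus. \<phi> z = 0"
    using Lp_norm_eq_0_iff [OF \<phi>] by simp
  then have "AE z in torus. f z * conj_power q (\<phi> z) = 0"
    by (auto simp: conj_power_def)
  then show ?thesis
    unfolding duality_def by (rule integral_eq_zero_AE)
next
  case False
  then have pos: "0 < Lp_norm q \<phi>" "0 < Lp_mass q \<phi>"
    using Lp_norm_nonneg [of q \<phi>] Lp_mass_nonneg [of q \<phi>] by (auto simp: Lp_norm_mass less_le)
  show ?thesis
  proof (rule ccontr)
    assume nz: "duality q \<phi> f \<noteq> 0"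
    \<comment> \<open>Hoelder's inequality keeps every g in the kernel at distance at least e from
      f.\<close>
    define e where "e = norm (duality q \<phi> f) * Lp_norm q \<phi> / Lp_mass q \<phi>"
    have "0 < e"
      using nz pos by (simp add: e_def)
    then obtain g where g: "g \<in> Lp q" "duality q \<phi> g = 0" "Lp_norm q (\<lambda>z. f z - g z) < e"
      using approx by blast
    have "norm (duality q \<phi> (\<lambda>z. f z - g z)) * Lp_norm q \<phi> \<le> Lp_mass q \<phi> * Lp_norm q (\<lambda>z. f z - g z)"
      using q f g \<phi> by (intro norm_duality_le Lp_diff)
    also have "\<dots> < Lp_mass q \<phi> * e"
      using pos g by simp
    also have "\<dots> = norm (duality q \<phi> f) * Lp_norm q \<phi>"
      using pos by (simp add: e_def)
    finally show False
      using q f g \<phi> by (simp add: duality_diff)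
  qed
qed

text \<open>W is a general L^2 function: it will represent a difference of two functionals and is
  usually not analytic.\<close>

lemma pairing_zero_on_H2:
  assumes W: "W \<in> Lp 2" and zero: "\<And>g. analytic_polynomial g \<Longrightarrow> pairing g W = 0" and f: "f \<in> Hp 2"
  shows "pairing f W = 0"
proof -
  have "duality 2 W f = 0"
  proof (rule duality_zero_closure)
    fix e :: real assume e: "0 < e"
    then obtain g where g: "analytic_polynomial g" "Lp_mass 2 (\<lambda>z. f z - g z) < e powr 2"
      using analytic_polynomial_dense_H2 [OF f, of "e powr 2"] by auto
    then have "Lp_mass 2 (\<lambda>z. f z - g z) powr (1 / 2) < (e powr 2) powr (1 / 2)"
      by (intro powr_less_mono2 Lp_mass_nonneg) auto
    then have "Lp_norm 2 (\<lambda>z. f z - g z) < e"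
      using e unfolding Lp_norm_mass powr_powr by simp
    then show "\<exists>g\<in>Lp 2. duality 2 W g = 0 \<and> Lp_norm 2 (\<lambda>z. f z - g z) < e"
      using g zero by (intro bexI [of _ g]) (auto simp: duality_2 Hp_Lp analytic_polynomial_Hp)
  qed (use W f in \<open>auto simp: Hp_Lp\<close>)
  then show ?thesis
    by (simp add: duality_2)
qed

section \<open>Hilbert points\<close>

lemma orthogonal_to_scale:
  assumes "1 < p" "f \<in> orthogonal_to p \<phi>"
  shows "(\<lambda>z. c * f z) \<in> orthogonal_to p \<phi>"
proof (cases "p < 2")
  case True
  have "\<exists>g\<in>{g. analytic_polynomial g \<and> pairing g \<phi> = 0}. Lp_norm p (\<lambda>z. c * f z - g z) < e"
    if e: "0 < e" for e
  proof -
    \<comment> \<open>Adding 1 keeps the divisor positive when c = 0.\<close>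
    have c: "0 < norm c + 1"
      by (simp add: add_nonneg_pos)
    then have "0 < e / (norm c + 1)"
      using e by simp
    moreover have "\<forall>e>0. \<exists>g. analytic_polynomial g \<and> pairing g \<phi> = 0 \<and> Lp_norm p (\<lambda>z. f z - g z) < e"
      using assms True by (auto simp: orthogonal_to_def Hp_closure_def)
    ultimately obtain g where g: "analytic_polynomial g" "pairing g \<phi> = 0"
      "Lp_norm p (\<lambda>z. f z - g z) < e / (norm c + 1)"
      by blast
    have "Lp_norm p (\<lambda>z. c * f z - c * g z) = norm c * Lp_norm p (\<lambda>z. f z - g z)"
      using assms by (simp add: Lp_norm_scale flip: right_diff_distrib)
    also have "\<dots> \<le> (norm c + 1) * Lp_norm p (\<lambda>z. f z - g z)"
      by (intro mult_right_mono Lp_norm_nonneg) simp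
    also have "\<dots> < e"
      using g c by (simp add: field_simps)
    finally have "Lp_norm p (\<lambda>z. c * f z - c * g z) < e" .
    moreover have "pairing (\<lambda>z. c * g z) \<phi> = 0"
      using g by (simp add: duality_scale flip: duality_2)
    ultimately show ?thesis
      using analytic_polynomial_scale [OF g(1), of c] by (intro bexI [of _ "\<lambda>z. c * g z"] CollectI conjI)
  qed
  then show ?thesis
    using assms True by (simp add: orthogonal_to_def Hp_closure_def Hp_scale)
next
  case False
  then show ?thesis
    using assms by (simp add: orthogonal_to_def Hp_scale duality_scale flip: duality_2)
qed

lemma hilbert_point_iff_duality_zero:
  assumes p: "1 < p" and \<phi>: "\<phi> \<in> Hp p" and nontrivial: "\<not> (AE z in torus. \<phi> z = 0)"
  shows "hilbert_point p \<phi> \<longleftrightarrow> (\<forall>f\<in>orthogonal_to p \<phi>. duality p \<phi> f = 0)"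
proof -
  have "orthogonal_to p \<phi> \<subseteq> Lp p"
    by (auto simp: orthogonal_to_def Hp_closure_def Hp_Lp)
  then show ?thesis
    unfolding hilbert_point_def
    using norm_minimal_iff_duality_zero [OF p Hp_Lp [OF \<phi>] _ orthogonal_to_scale [OF p]] \<phi> nontrivial
    by simp
qed

text \<open>Here H^p lies in H^2 and orthogonality is a genuine integral condition; subtracting the
  component along \<phi> makes any f orthogonal to \<phi> without leaving H^p.\<close>

lemma duality_zero_iff_proportional_ge_2:
  fixes \<phi> :: "('d::finite \<Rightarrow> complex) \<Rightarrow> complex"
  assumes p: "2 \<le> p" and \<phi>: "\<phi> \<in> Hp 2 \<inter> Hp p" and nontrivial: "\<not> (AE z in torus. \<phi> z = 0)"
  shows "(\<forall>f\<in>orthogonal_to p \<phi>. duality p \<phi> f = 0) \<longleftrightarrow>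
    (\<forall>f\<in>Hp 2 \<inter> Hp p. duality p \<phi> f * Lp_mass 2 \<phi> = duality 2 \<phi> f * Lp_mass p \<phi>)"
    (is "?L \<longleftrightarrow> ?R")
proof
  have mass: "Lp_mass 2 \<phi> \<noteq> 0"
    using \<phi> nontrivial Lp_mass_eq_0_iff [of \<phi> 2] by (auto simp: Hp_Lp)
  have orth: "f \<in> orthogonal_to p \<phi> \<longleftrightarrow> f \<in> Hp p \<and> duality 2 \<phi> f = 0" for f
    using p by (simp add: orthogonal_to_def duality_2)
  show ?R if ?L
  proof
    fix f :: "('d \<Rightarrow> complex) \<Rightarrow> complex" assume f: "f \<in> Hp 2 \<inter> Hp p"
    define c where "c = duality 2 \<phi> f / Lp_mass 2 \<phi>"
    have diff: "duality q \<phi> (\<lambda>z. f z - c * \<phi> z) = duality q \<phi> f - c * Lp_mass q \<phi>"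
      if "1 < q" "f \<in> Hp q" "\<phi> \<in> Hp q" for q
      using that by (simp add: duality_diff Hp_Lp Lp_scale duality_scale duality_self)
    have "(\<lambda>z. f z - c * \<phi> z) \<in> orthogonal_to p \<phi>"
      unfolding orth using p f \<phi> mass by (auto simp: diff intro!: Hp_diff Hp_scale) (simp add: c_def)
    then have "duality p \<phi> (\<lambda>z. f z - c * \<phi> z) = 0"
      using that by blast
    then show "duality p \<phi> f * Lp_mass 2 \<phi> = duality 2 \<phi> f * Lp_mass p \<phi>"
      using p f \<phi> mass by (simp add: diff) (simp add: c_def)
  qed
  show ?L if ?R
  proof
    fix f assume "f \<in> orthogonal_to p \<phi>"
    then have f: "f \<in> Hp p" "duality 2 \<phi> f = 0"
      by (auto simp: orth)
    then have "f \<in> Hp 2"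
      using p Hp_mono_exponent [of 2 p] by auto
    then have "duality p \<phi> f * Lp_mass 2 \<phi> = duality 2 \<phi> f * Lp_mass p \<phi>"
      using that f by blast
    then show "duality p \<phi> f = 0"
      using f mass by simp
  qed
qed

text \<open>For \<open>p < 2\<close> the function \<open>conj_power p \<circ> \<phi>\<close> has modulus \<open>\<bar>\<phi>\<bar>\<^sup>p\<^sup>-\<^sup>1 \<le> 1 + \<bar>\<phi>\<bar>\<close>, so both dualities
  are continuous on \<open>H\<^sup>2\<close> and may be compared on the dense set of polynomials.\<close>

lemma duality_zero_iff_proportional_less_2:
  fixes \<phi> :: "('d::finite \<Rightarrow> complex) \<Rightarrow> complex"
  assumes p: "1 < p" "p < 2" and \<phi>: "\<phi> \<in> Hp 2 \<inter> Hp p" and nontrivial: "\<not> (AE z in torus. \<phi> z = 0)"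
  shows "(\<forall>f\<in>orthogonal_to p \<phi>. duality p \<phi> f = 0) \<longleftrightarrow>
    (\<forall>f\<in>Hp 2 \<inter> Hp p. duality p \<phi> f * Lp_mass 2 \<phi> = duality 2 \<phi> f * Lp_mass p \<phi>)"
    (is "?L \<longleftrightarrow> ?R")
proof
  have mass: "Lp_mass 2 \<phi> \<noteq> 0"
    using \<phi> nontrivial Lp_mass_eq_0_iff [of \<phi> 2] by (auto simp: Hp_Lp)
  have orth: "orthogonal_to p \<phi> = Hp_closure p {g. analytic_polynomial g \<and> duality 2 \<phi> g = 0}"
    using p by (simp add: orthogonal_to_def duality_2)
  have polynomial_Hp: "g \<in> Hp 2 \<inter> Hp p" if "analytic_polynomial g" for g :: "('d \<Rightarrow> complex) \<Rightarrow> complex"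
    using that p by (simp add: analytic_polynomial_Hp)
  show ?L if ?R
  proof
    fix f assume "f \<in> orthogonal_to p \<phi>"
    then have f: "f \<in> Hp p"
      and approx: "\<And>e. 0 < e \<Longrightarrow> \<exists>g. analytic_polynomial g \<and> duality 2 \<phi> g = 0 \<and> Lp_norm p (\<lambda>z. f z - g z) < e"
      unfolding orth Hp_closure_def by auto
    have "duality p \<phi> g = 0" if "analytic_polynomial g" "duality 2 \<phi> g = 0" for g
      using \<open>?R\<close> polynomial_Hp [OF that(1)] that(2) mass
      by (metis mult_eq_0_iff mult_zero_left of_real_eq_0_iff)
    then have "\<exists>g\<in>Lp p. duality p \<phi> g = 0 \<and> Lp_norm p (\<lambda>z. f z - g z) < e" if "0 < e" for e
      using approx [OF that] polynomial_Hp by (meson Hp_Lp IntD2)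
    then show "duality p \<phi> f = 0"
      using p f \<phi> by (intro duality_zero_closure) (auto simp: Hp_Lp)
  qed
  show ?R if ?L
  proof -
    have polynomial_zero: "duality p \<phi> g = 0" if g: "analytic_polynomial g" "duality 2 \<phi> g = 0" for g
    proof -
      have "g \<in> orthogonal_to p \<phi>"
        unfolding orth Hp_closure_def using g polynomial_Hp [OF g(1)] p
        by (auto intro!: exI [of _ g] simp: Lp_norm_def)
      then show ?thesis
        using \<open>?L\<close> by blast
    qed
    \<comment> \<open>Some polynomial must detect \<phi>, since otherwise density would make \<phi>
      orthogonal to itself.\<close>
    have "\<exists>g. analytic_polynomial g \<and> pairing g \<phi> \<noteq> 0"
    proof (rule ccontr)
      assume "\<not> ?thesis"
      then have "pairing \<phi> \<phi> = 0"
        using \<phi> by (subst pairing_zero_on_H2) (auto simp: Hp_Lp)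
      then show False
        using mass duality_self [of 2 \<phi>] by (simp add: duality_2)
    qed
    then obtain g0 where g0: "analytic_polynomial g0" "duality 2 \<phi> g0 \<noteq> 0"
      by (auto simp: duality_2)
    define c where "c = duality p \<phi> g0 / duality 2 \<phi> g0"
    \<comment> \<open>W represents \<open>duality p \<phi> f - c * duality 2 \<phi> f\<close> as a
      pairing; c is chosen to make this vanish at g0.\<close>
    define W where "W z = cnj (conj_power p (\<phi> z)) - cnj c * \<phi> z" for z
    have \<phi>_Lp: "\<phi> \<in> Lp 2"
      using \<phi> Hp_Lp by blast
    then have "(\<lambda>z. complex_of_real (norm (\<phi> z))) \<in> borel_measurable torus"
      by measurable
    then have "(\<lambda>z. of_real (norm (\<phi> z))) \<in> Lp 2"
      by (rule Lp_mono_norm [OF _ \<phi>_Lp]) auto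
    then have dominant: "(\<lambda>z. 1 + of_real (norm (\<phi> z))) \<in> Lp 2"
      by (intro Lp_add trig_polynomial_Lp [OF trig_polynomial_const]) auto
    have conj_power_Lp: "(\<lambda>z. cnj (conj_power p (\<phi> z))) \<in> Lp 2"
    proof (rule Lp_mono_norm [OF _ dominant])
      show "(\<lambda>z. cnj (conj_power p (\<phi> z))) \<in> borel_measurable torus"
        using p \<phi>_Lp by measurable
      fix z
      have "norm (\<phi> z) powr (p - 1) \<le> 1 + norm (\<phi> z)"
      proof (cases "norm (\<phi> z) \<le> 1")
        case True
        then show ?thesis
          using p powr_le1 [of "p - 1" "norm (\<phi> z)"] by (simp add: add_increasing2)
      next
        case False
        then have "norm (\<phi> z) powr (p - 1) \<le> norm (\<phi> z) powr 1"
          using p by (intro powr_mono) auto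
        then show ?thesis
          by simp
      qed
      moreover have "norm (1 + complex_of_real (norm (\<phi> z))) = 1 + norm (\<phi> z)"
        by (metis abs_of_nonneg add_nonneg_nonneg norm_ge_zero norm_of_real of_real_1 of_real_add zero_le_one)
      ultimately show "norm (cnj (conj_power p (\<phi> z))) \<le> norm (1 + complex_of_real (norm (\<phi> z)))"
        by (simp add: norm_conj_power)
    qed simp
    then have W: "W \<in> Lp 2"
      unfolding W_def using \<phi> by (intro Lp_diff Lp_scale) (auto simp: Hp_Lp)
    have pairing_W: "pairing f W = duality p \<phi> f - c * duality 2 \<phi> f" if "f \<in> Hp 2 \<inter> Hp p" for f
    proof -
      have "integrable torus (\<lambda>z. f z * conj_power p (\<phi> z))" "integrable torus (\<lambda>z. f z * conj_power 2 (\<phi> z))"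
        using that \<phi> p by (auto intro!: integrable_mult_conj_power simp: Hp_Lp)
      then have "duality p \<phi> f - c * duality 2 \<phi> f =
          (LINT z|torus. f z * conj_power p (\<phi> z) - c * (f z * conj_power 2 (\<phi> z)))"
        by (simp add: duality_def)
      also have "\<dots> = pairing f W"
        unfolding pairing_def by (intro Bochner_Integration.integral_cong) (simp_all add: W_def conj_power_2 algebra_simps)
      finally show ?thesis ..
    qed
    have "pairing g W = 0" if g: "analytic_polynomial g" for g
    proof -
      \<comment> \<open>g is moved into the kernel of \<open>duality 2 \<phi>\<close> along g0
        rather than along \<phi>, so that the result stays a polynomial.\<close>
      define s where "s = - (duality 2 \<phi> g / duality 2 \<phi> g0)"
      have sum: "duality q \<phi> (\<lambda>z. g z + s * g0 z) = duality q \<phi> g + s * duality q \<phi> g0"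
        if "1 < q" "\<phi> \<in> Lp q" for q
        using that g g0 by (simp add: duality_add Lp_scale duality_scale analytic_polynomial_Hp Hp_Lp)
      have "duality 2 \<phi> (\<lambda>z. g z + s * g0 z) = 0"
        using \<phi> g0 by (subst sum) (auto simp: Hp_Lp s_def)
      then have "duality p \<phi> (\<lambda>z. g z + s * g0 z) = 0"
        using g g0 by (intro polynomial_zero analytic_polynomial_add analytic_polynomial_scale)
      then have "duality p \<phi> g = c * duality 2 \<phi> g"
        using p \<phi> by (subst (asm) sum) (auto simp: Hp_Lp s_def c_def field_simps)
      then show ?thesis
        using pairing_W polynomial_Hp [OF g] by simp
    qed
    then have eq: "duality p \<phi> f = c * duality 2 \<phi> f" if "f \<in> Hp 2 \<inter> Hp p" for f
      using pairing_zero_on_H2 [OF W] pairing_W that by force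
    \<comment> \<open>Evaluation at \<phi> identifies c as the ratio of the masses.\<close>
    have "c * Lp_mass 2 \<phi> = Lp_mass p \<phi>"
      using eq [OF \<phi>] by (simp add: duality_self)
    then show ?R
      using eq by (auto simp flip: \<open>c * Lp_mass 2 \<phi> = Lp_mass p \<phi>\<close>)
  qed
qed

theorem corollary2p4:
  fixes p :: real and \<phi> :: "('d::finite \<Rightarrow> complex) \<Rightarrow> complex"
  assumes "1 < p"
    and "\<phi> \<in> Hp 2 \<inter> Hp p"
    and "\<not> (AE z in torus. \<phi> z = 0)"
  shows "hilbert_point p \<phi> \<longleftrightarrow>
    supporting_hyperplane p \<phi> \<inter> Hp 2 = supporting_hyperplane 2 \<phi> \<inter> Hp p"
proof -
  have "hilbert_point p \<phi> \<longleftrightarrow> (\<forall>f\<in>orthogonal_to p \<phi>. duality p \<phi> f = 0)"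
    using assms by (intro hilbert_point_iff_duality_zero) auto
  also have "\<dots> \<longleftrightarrow>
      (\<forall>f\<in>Hp 2 \<inter> Hp p. duality p \<phi> f * Lp_mass 2 \<phi> = duality 2 \<phi> f * Lp_mass p \<phi>)"
    using assms by (cases "p < 2")
      (simp_all add: duality_zero_iff_proportional_less_2 duality_zero_iff_proportional_ge_2)
  also have "\<dots> \<longleftrightarrow> supporting_hyperplane p \<phi> \<inter> Hp 2 = supporting_hyperplane 2 \<phi> \<inter> Hp p"
    using assms by (intro supporting_hyperplanes_agree_iff [symmetric]) auto
  finally show ?thesis .
qed

end
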